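(* Let $\Lambda=\Lambda(\mathbb{F}_n)$ be the space of Schreier graphs of $\mathbb{F}_n=\langle a_1,\ldots,a_n\rangle$, let $\Omega$ be the space of connected rooted $2n$-regular graphs, and let $f:\Lambda\to\Omega$ be the forgetful map sending a Schreier graph to its underlying unlabeled, undirected rooted graph. Then the image under $f$ of a unimodular measure is unimodular, i.e. $f_*\,\mathcal{U}(\Lambda)\subseteq\mathcal{U}(\Omega)$.
   Context: Graphs may have loops and multiple edges; a loop contributes $2$ to the degree. $\Omega$ is the set of root-preserving isomorphism classes of connected rooted graphs $(\Gamma,x)$ in which every vertex has degree $2n$. A Schreier graph is such a rooted graph whose edges are oriented and labeled with $a_1,\ldots,a_n$ so that every vertex has, for each $i$, precisely one incoming and one outgoing edge labeled $a_i$; $\Lambda$ is the set of isomorphism classes of Schreier graphs, isomorphisms preserving root, labels and orientations. Both $X=\Omega$ and $X=\Lambda$ carry the compact topology whose base is given by the cylinder sets $\{(\Gamma,x): U_r(x)\cong U\}$, where $U_r(x)$ is the $r$-neighborhood of the root (labeled in the case of $\Lambda$). Measures are Borel probability measures. Unimodularity, for $X=\Omega$ or $\Lambda$: let $\widetilde X$ be the space of isomorphism classes of doubly rooted graphs $(\Gamma,x,y)$ (of the type in $X$) with principal root $x$ and secondary root $y$, with projections $\pi_x(\Gamma,x,y)=(\Gamma,x)$ and $\pi_y(\Gamma,x,y)=(\Gamma,y)$ to $X$. For a probability measure $\mu$ on $X$, $\widetilde\mu_x$ is the measure on $\widetilde X$ obtained by integrating against $\mu$ the measures on the fibers $\pi_x^{-1}(\Gamma,x)$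 that assign to the class of $(\Gamma,x,y)$ the mass $|\mathrm{Aut}_x(\Gamma)\cdot y|$, the cardinality of the orbit of $y$ under the stabilizer of $x$ in $\mathrm{Aut}(\Gamma)$ (automorphisms preserve labels and orientations when $X=\Lambda$); $\widetilde\mu_y$ is defined analogously from $\pi_y$, with masses $|\mathrm{Aut}_y(\Gamma)\cdot x|$. $\mu$ is unimodular if $\widetilde\mu_x=\widetilde\mu_y$, and $\mathcal{U}(X)$ denotes the set of unimodular measures on $X$. *)

theory Defs
  imports "HOL-Probability.Probability" "HOL-Library.Uprod" "Graph_Theory.Digraph"
begin

text \<open>
  The constructions common to unlabeled graphs and Schreier graphs are carried out over an
  arbitrary type \<open>'g\<close> of (possibly decorated) graphs with vertices in \<^typ>\<open>nat\<close>:

  \<^item> \<open>vertices G\<close> is the vertex set of \<open>G\<close>;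
  \<^item> \<open>iso G H \<phi>\<close> says that \<open>\<phi>\<close> is the vertex part of an isomorphism from \<open>G\<close> to \<open>H\<close>
    (the values of \<open>\<phi>\<close> outside \<open>vertices G\<close> are irrelevant);
  \<^item> \<open>nbhd r G x\<close> is the \<open>r\<close>-neighborhood of \<open>x\<close> in \<open>G\<close>;
  \<^item> \<open>graphs\<close> is the class of graphs under consideration.

  Connected graphs of bounded degree have countably many vertices and edges, so every such graph
  has an isomorphic copy with vertices and edges in \<^typ>\<open>nat\<close>. An isomorphism class is
  represented by the set of all its representatives of this kind.
\<close>

locale graph_space =
  fixes vertices :: "'g \<Rightarrow> nat set"
    and iso :: "'g \<Rightarrow> 'g \<Rightarrow> (nat \<Rightarrow> nat) \<Rightarrow> bool"
    and nbhd :: "nat \<Rightarrow> 'g \<Rightarrow> nat \<Rightarrow> 'g"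
    and graphs :: "'g set"
begin

definition rooted :: "('g \<times> nat) set" where
  "rooted = {(G, x). G \<in> graphs \<and> x \<in> vertices G}"

definition rooted_iso :: "(('g \<times> nat) \<times> ('g \<times> nat)) set" where
  "rooted_iso = {((G, x), (H, u)). (G, x) \<in> rooted \<and> (H, u) \<in> rooted \<and>
     (\<exists>\<phi>. iso G H \<phi> \<and> \<phi> x = u)}"

definition rooted_classes :: "('g \<times> nat) set set" where
  "rooted_classes = rooted // rooted_iso"

definition cylinder :: "nat \<Rightarrow> 'g \<Rightarrow> nat \<Rightarrow> ('g \<times> nat) set set" where
  "cylinder r U u = {p \<in> rooted_classes. \<exists>(G, x) \<in> p. \<exists>\<phi>. iso (nbhd r G x) U \<phi> \<and> \<phi> x = u}"

text \<open>
  Any two cylinder sets are nested or disjoint, so they form a base, and not only a subbase, of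
  the topology they generate.
\<close>

definition cylinder_topology :: "('g \<times> nat) set topology" where
  "cylinder_topology = topology_generated_by {cylinder r U u | r U u. True}"

definition borel_sets :: "('g \<times> nat) set measure" where
  "borel_sets = sigma rooted_classes {A. openin cylinder_topology A}"

definition birooted :: "('g \<times> nat \<times> nat) set" where
  "birooted = {(G, x, y). G \<in> graphs \<and> x \<in> vertices G \<and> y \<in> vertices G}"

definition birooted_iso :: "(('g \<times> nat \<times> nat) \<times> ('g \<times> nat \<times> nat)) set" where
  "birooted_iso = {((G, x, y), (H, u, v)). (G, x, y) \<in> birooted \<and> (H, u, v) \<in> birooted \<and>
     (\<exists>\<phi>. iso G H \<phi> \<and> \<phi> x = u \<and> \<phi> y = v)}"

definition birooted_classes :: "('g \<times> nat \<times> nat) set set" where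
  "birooted_classes = birooted // birooted_iso"

text \<open>
  Doubly rooted graphs carry the analogous topology: a cylinder set prescribes a neighborhood of
  the principal root together with the position of the secondary root in it. Exchanging the roles
  of the two roots yields the same topology, since \<open>nbhd r G y\<close> is determined by a sufficiently
  large neighborhood of \<open>x\<close>.
\<close>

definition bicylinder :: "nat \<Rightarrow> 'g \<Rightarrow> nat \<Rightarrow> nat \<Rightarrow> ('g \<times> nat \<times> nat) set set" where
  "bicylinder r U u v = {c \<in> birooted_classes. \<exists>(G, x, y) \<in> c. y \<in> vertices (nbhd r G x) \<and>
     (\<exists>\<phi>. iso (nbhd r G x) U \<phi> \<and> \<phi> x = u \<and> \<phi> y = v)}"

definition bicylinder_topology :: "('g \<times> nat \<times> nat) set topology" where
  "bicylinder_topology = topology_generated_by {bicylinder r U u v | r U u v. True}"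

definition biborel_sets :: "('g \<times> nat \<times> nat) set measure" where
  "biborel_sets = sigma birooted_classes {A. openin bicylinder_topology A}"

text \<open>
  A map between classes that is given on representatives is defined by saturating the image of
  the class; \<open>the_elem\<close> extracts the common value of an isomorphism invariant.
\<close>

definition proj_x :: "('g \<times> nat \<times> nat) set \<Rightarrow> ('g \<times> nat) set" where
  "proj_x c = rooted_iso `` ((\<lambda>(G, x, y). (G, x)) ` c)"

definition proj_y :: "('g \<times> nat \<times> nat) set \<Rightarrow> ('g \<times> nat) set" where
  "proj_y c = rooted_iso `` ((\<lambda>(G, x, y). (G, y)) ` c)"

definition stabilizer_orbit :: "'g \<Rightarrow> nat \<Rightarrow> nat \<Rightarrow> nat set" where
  "stabilizer_orbit G x y = {\<phi> y | \<phi>. iso G G \<phi> \<and> \<phi> x = x}"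

definition mass_x :: "('g \<times> nat \<times> nat) set \<Rightarrow> nat" where
  "mass_x c = the_elem ((\<lambda>(G, x, y). card (stabilizer_orbit G x y)) ` c)"

definition mass_y :: "('g \<times> nat \<times> nat) set \<Rightarrow> nat" where
  "mass_y c = the_elem ((\<lambda>(G, x, y). card (stabilizer_orbit G y x)) ` c)"

definition fiber_x :: "('g \<times> nat) set \<Rightarrow> ('g \<times> nat \<times> nat) set set" where
  "fiber_x p = {c \<in> birooted_classes. proj_x c = p}"

definition fiber_y :: "('g \<times> nat) set \<Rightarrow> ('g \<times> nat \<times> nat) set set" where
  "fiber_y p = {c \<in> birooted_classes. proj_y c = p}"

definition lift_x :: "('g \<times> nat) set measure \<Rightarrow> ('g \<times> nat \<times> nat) set measure" where
  "lift_x \<mu> = measure_of birooted_classes (sets biborel_sets)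
     (\<lambda>B. \<integral>\<^sup>+ p. emeasure (point_measure (fiber_x p) (\<lambda>c. of_nat (mass_x c))) (B \<inter> fiber_x p) \<partial>\<mu>)"

definition lift_y :: "('g \<times> nat) set measure \<Rightarrow> ('g \<times> nat \<times> nat) set measure" where
  "lift_y \<mu> = measure_of birooted_classes (sets biborel_sets)
     (\<lambda>B. \<integral>\<^sup>+ p. emeasure (point_measure (fiber_y p) (\<lambda>c. of_nat (mass_y c))) (B \<inter> fiber_y p) \<partial>\<mu>)"

definition unimodular_measures :: "('g \<times> nat) set measure set" where
  "unimodular_measures =
     {\<mu>. prob_space \<mu> \<and> sets \<mu> = sets borel_sets \<and> lift_x \<mu> = lift_y \<mu>}"

end

record ('v, 'e) multigraph =
  mverts :: "'v set"
  medges :: "'e set"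
  mends :: "'e \<Rightarrow> 'v uprod"

definition multigraph_wf :: "('v, 'e) multigraph \<Rightarrow> bool" where
  "multigraph_wf G \<longleftrightarrow> (\<forall>e \<in> medges G. set_uprod (mends G e) \<subseteq> mverts G)"

definition madj :: "('v, 'e) multigraph \<Rightarrow> ('v \<times> 'v) set" where
  "madj G = {(u, v). \<exists>e \<in> medges G. mends G e = Upair u v}"

definition multigraph_connected :: "('v, 'e) multigraph \<Rightarrow> bool" where
  "multigraph_connected G \<longleftrightarrow> mverts G \<noteq> {} \<and> (\<forall>u \<in> mverts G. \<forall>v \<in> mverts G. (u, v) \<in> (madj G)\<^sup>*)"

text \<open>Loops contribute 2: once to each summand.\<close>

definition mdegree :: "('v, 'e) multigraph \<Rightarrow> 'v \<Rightarrow> nat" where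
  "mdegree G v = card {e \<in> medges G. v \<in> set_uprod (mends G e)}
     + card {e \<in> medges G. mends G e = Upair v v}"

text \<open>Finiteness is required separately because \<^const>\<open>card\<close> is 0 on infinite sets.\<close>

definition regular_multigraphs :: "nat \<Rightarrow> ('v, 'e) multigraph set" where
  "regular_multigraphs d = {G. multigraph_wf G \<and> multigraph_connected G \<and>
     (\<forall>v \<in> mverts G. finite {e \<in> medges G. v \<in> set_uprod (mends G e)} \<and> mdegree G v = d)}"

definition multigraph_iso ::
    "('v, 'e) multigraph \<Rightarrow> ('v, 'e) multigraph \<Rightarrow> ('v \<Rightarrow> 'v) \<Rightarrow> bool" where
  "multigraph_iso G H \<phi> \<longleftrightarrow> bij_betw \<phi> (mverts G) (mverts H) \<and>
     (\<exists>\<psi>. bij_betw \<psi> (medges G) (medges H) \<and>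
       (\<forall>e \<in> medges G. mends H (\<psi> e) = map_uprod \<phi> (mends G e)))"

definition mball :: "nat \<Rightarrow> ('v, 'e) multigraph \<Rightarrow> 'v \<Rightarrow> 'v set" where
  "mball r G x = {v \<in> mverts G. \<exists>k \<le> r. (x, v) \<in> madj G ^^ k}"

definition multigraph_nbhd :: "nat \<Rightarrow> ('v, 'e) multigraph \<Rightarrow> 'v \<Rightarrow> ('v, 'e) multigraph" where
  "multigraph_nbhd r G x = G\<lparr>mverts := mball r G x,
     medges := {e \<in> medges G. set_uprod (mends G e) \<subseteq> mball r G x}\<rparr>"

text \<open>The label \<open>i\<close> stands for the generator \<open>a\<^sub>i\<close>.\<close>

record ('v, 'e) labeled_digraph = "('v, 'e) pre_digraph" +
  label :: "'e \<Rightarrow> nat"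

definition underlying :: "('v, 'e) labeled_digraph \<Rightarrow> ('v, 'e) multigraph" where
  "underlying G = \<lparr>mverts = verts G, medges = arcs G, mends = (\<lambda>e. Upair (tail G e) (head G e))\<rparr>"

definition schreier_graphs :: "nat \<Rightarrow> ('v, 'e) labeled_digraph set" where
  "schreier_graphs n = {G. underlying G \<in> regular_multigraphs (2 * n) \<and>
     (\<forall>e \<in> arcs G. label G e \<in> {1..n}) \<and>
     (\<forall>v \<in> verts G. \<forall>i \<in> {1..n}.
        (\<exists>!e. e \<in> arcs G \<and> head G e = v \<and> label G e = i) \<and>
        (\<exists>!e. e \<in> arcs G \<and> tail G e = v \<and> label G e = i))}"

definition labeled_iso ::
    "('v, 'e) labeled_digraph \<Rightarrow> ('v, 'e) labeled_digraph \<Rightarrow> ('v \<Rightarrow> 'v) \<Rightarrow> bool" where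
  "labeled_iso G H \<phi> \<longleftrightarrow> bij_betw \<phi> (verts G) (verts H) \<and>
     (\<exists>\<psi>. bij_betw \<psi> (arcs G) (arcs H) \<and>
       (\<forall>e \<in> arcs G. tail H (\<psi> e) = \<phi> (tail G e) \<and> head H (\<psi> e) = \<phi> (head G e) \<and>
          label H (\<psi> e) = label G e))"

text \<open>Distances are measured in the underlying undirected graph.\<close>

definition labeled_nbhd :: "nat \<Rightarrow> ('v, 'e) labeled_digraph \<Rightarrow> 'v \<Rightarrow> ('v, 'e) labeled_digraph" where
  "labeled_nbhd r G x = G\<lparr>verts := mball r (underlying G) x,
     arcs := {e \<in> arcs G. {tail G e, head G e} \<subseteq> mball r (underlying G) x}\<rparr>"

global_interpretation Omega: graph_space "mverts :: (nat, nat) multigraph \<Rightarrow> nat set" multigraph_iso multigraph_nbhd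
    "regular_multigraphs (2 * n)"
  for n :: nat
  defines Omega = Omega.rooted_classes
    and Omega_iso = Omega.rooted_iso
    and Omega_borel = Omega.borel_sets
    and Omega_unimodular = Omega.unimodular_measures
  .

global_interpretation Lambda: graph_space "verts :: (nat, nat) labeled_digraph \<Rightarrow> nat set" labeled_iso
    labeled_nbhd "schreier_graphs n"
  for n :: nat
  defines Lambda = Lambda.rooted_classes
    and Lambda_iso = Lambda.rooted_iso
    and Lambda_borel = Lambda.borel_sets
    and Lambda_unimodular = Lambda.unimodular_measures
  .

definition forget ::
    "nat \<Rightarrow> ((nat, nat) labeled_digraph \<times> nat) set \<Rightarrow> ((nat, nat) multigraph \<times> nat) set" where
  "forget n p = Omega_iso n `` ((\<lambda>(G, x). (underlying G, x)) ` p)"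

end

theory Submission
  imports Defs
begin

text \<open>
  The measure on the fiber over \<open>(\<Gamma>, x)\<close> gives the class of \<open>(\<Gamma>, x, y)\<close> the mass
  \<open>|Aut\<^sub>x(\<Gamma>) \<cdot> y|\<close>. Two secondary roots define the same class precisely if they lie in the same orbit,
  so this measure is the image of the counting measure on the vertices of \<open>\<Gamma>\<close> under
  \<open>y \<mapsto> [(\<Gamma>, x, y)]\<close> (\<open>fiber_mass_x_class\<close>). Likewise, the fiber of the second projection carries the
  image of the counting measure under \<open>y \<mapsto> [(\<Gamma>, y, x)]\<close>. In this description the automorphism
  groups have disappeared, although forgetting labels may enlarge them.

  Forgetting labels and orientations does not change the vertices. Hence for the induced map \<open>g\<close> on
  doubly rooted graphs (\<open>map_biroot\<close>), the mass of a set \<open>B\<close> in the fiber over \<open>f(\<Gamma>, x)\<close> equals the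
  mass of \<open>g\<^sup>-\<^sup>1(B)\<close> in the fiber over \<open>(\<Gamma>, x)\<close> (\<open>fiber_mass_map_root\<close>). Integrating
  against \<open>\<mu>\<close> shows that both lifts of \<open>f\<^sub>*\<mu>\<close> are the images under \<open>g\<close> of the corresponding lifts of
  \<open>\<mu>\<close>, so they agree if those of \<open>\<mu>\<close> do (\<open>unimodular_distr\<close>).

  Most of the work is measure theoretic. The maps \<open>f\<close> and \<open>g\<close> are continuous, and the
  mass of a Borel set in a fiber depends measurably on the base point (\<open>measurable_fiber_mass_x\<close>).
  For an open set, the number of secondary roots within distance \<open>r\<close> that lead into
  it is lower semicontinuous in the base point; the general case follows by a Dynkin argument and the
  limit \<open>r \<rightarrow> \<infinity>\<close>. Exchanging the roots is continuous, which transfers this to the second projection.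

  The argument uses only that isomorphisms restrict to neighborhoods and that the neighborhoods are
  finite and exhaust the graph. It is carried out for all such spaces of graphs at once, and
  multigraphs and Schreier graphs are shown to be instances.
\<close>

section \<open>Point measures\<close>

lemma emeasure_point_measure_nn_integral:
  fixes f :: "'b \<Rightarrow> ennreal"
  assumes "X \<subseteq> A"
  shows "emeasure (point_measure A f) X = (\<integral>\<^sup>+ c. f c \<partial>count_space X)"
proof -
  have "emeasure (point_measure A f) X = (\<integral>\<^sup>+ c. f c * indicator X c \<partial>count_space A)"
    unfolding point_measure_def using assms by (subst emeasure_density) auto
  also have "\<dots> = (\<integral>\<^sup>+ c. f c * indicator X c * indicator A c \<partial>count_space UNIV)"
    by (cases "A = UNIV") (simp_all add: nn_integral_count_space_indicator)
  also have "\<dots> = (\<integral>\<^sup>+ c. f c * indicator X c \<partial>count_space UNIV)"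
    using assms by (intro nn_integral_cong) (auto simp: indicator_def)
  also have "\<dots> = (\<integral>\<^sup>+ c. f c \<partial>count_space X)"
    by (cases "X = UNIV") (simp_all add: nn_integral_count_space_indicator)
  finally show ?thesis .
qed

section \<open>Spaces of rooted graphs with local isomorphisms\<close>

text \<open>
  What the argument uses about graphs, stated once for unlabeled and labeled graphs: isomorphisms form
  a groupoid, an isomorphism restricts to neighborhoods, and an isomorphism of \<open>r\<close>-neighborhoods of
  the roots restricts to the smaller neighborhoods that fit inside them, also around points other
  than the root. The neighborhoods are finite and exhaust the graph; this is where bounded degree and
  connectedness enter.
\<close>

locale local_graph_space = graph_space vertices iso nbhd graphs
  for vertices :: "'g \<Rightarrow> nat set"
    and iso :: "'g \<Rightarrow> 'g \<Rightarrow> (nat \<Rightarrow> nat) \<Rightarrow> bool"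
    and nbhd :: "nat \<Rightarrow> 'g \<Rightarrow> nat \<Rightarrow> 'g"
    and graphs :: "'g set" +
  assumes iso_refl: "iso G G id"
    and iso_comp: "iso G H \<phi> \<Longrightarrow> iso H K \<psi> \<Longrightarrow> iso G K (\<psi> \<circ> \<phi>)"
    and iso_bij: "iso G H \<phi> \<Longrightarrow> bij_betw \<phi> (vertices G) (vertices H)"
    and iso_inv: "G \<in> graphs \<Longrightarrow> iso G H \<phi> \<Longrightarrow> iso H G (inv_into (vertices G) \<phi>)"
    and iso_nbhd: "G \<in> graphs \<Longrightarrow> x \<in> vertices G \<Longrightarrow> iso G H \<phi> \<Longrightarrow>
      iso (nbhd r G x) (nbhd r H (\<phi> x)) \<phi>"
    and iso_nbhd_nbhd: "G \<in> graphs \<Longrightarrow> H \<in> graphs \<Longrightarrow> x \<in> vertices G \<Longrightarrow> \<phi> x \<in> vertices H \<Longrightarrow>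
      iso (nbhd r G x) (nbhd r H (\<phi> x)) \<phi> \<Longrightarrow> y \<in> vertices (nbhd k G x) \<Longrightarrow> k + s \<le> r \<Longrightarrow>
      iso (nbhd s G y) (nbhd s H (\<phi> y)) \<phi>"
    and nbhd_subset_nbhd: "G \<in> graphs \<Longrightarrow> y \<in> vertices (nbhd k G x) \<Longrightarrow> k + s \<le> r \<Longrightarrow>
      vertices (nbhd s G y) \<subseteq> vertices (nbhd r G x)"
    and root_in_nbhd: "G \<in> graphs \<Longrightarrow> x \<in> vertices G \<Longrightarrow> x \<in> vertices (nbhd r G x)"
    and finite_nbhd: "G \<in> graphs \<Longrightarrow> finite (vertices (nbhd r G x))"
    and Union_nbhd: "G \<in> graphs \<Longrightarrow> x \<in> vertices G \<Longrightarrow> (\<Union>r. vertices (nbhd r G x)) = vertices G"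
begin

lemma nbhd_mono:
  assumes "G \<in> graphs" "x \<in> vertices G" "s \<le> r"
  shows "vertices (nbhd s G x) \<subseteq> vertices (nbhd r G x)"
  using nbhd_subset_nbhd[of G x 0 x s r] root_in_nbhd assms by simp

lemma nbhd_subset:
  assumes "G \<in> graphs" "x \<in> vertices G"
  shows "vertices (nbhd r G x) \<subseteq> vertices G"
  using Union_nbhd[OF assms] by blast

lemma iso_nbhd_mono:
  assumes "G \<in> graphs" "H \<in> graphs" "x \<in> vertices G" "\<phi> x \<in> vertices H"
    and "iso (nbhd r G x) (nbhd r H (\<phi> x)) \<phi>" "s \<le> r"
  shows "iso (nbhd s G x) (nbhd s H (\<phi> x)) \<phi>"
  using iso_nbhd_nbhd[OF assms(1-5), of x 0 s] root_in_nbhd assms by simp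

abbreviation root_class :: "'g \<Rightarrow> nat \<Rightarrow> ('g \<times> nat) set" where
  "root_class G x \<equiv> rooted_iso `` {(G, x)}"

abbreviation biroot_class :: "'g \<Rightarrow> nat \<Rightarrow> nat \<Rightarrow> ('g \<times> nat \<times> nat) set" where
  "biroot_class G x y \<equiv> birooted_iso `` {(G, x, y)}"

lemma iso_inv_ex:
  assumes "G \<in> graphs" "iso G H \<phi>"
  obtains \<psi> where "iso H G \<psi>" "\<And>x. x \<in> vertices G \<Longrightarrow> \<psi> (\<phi> x) = x"
  using iso_inv[OF assms] bij_betw_inv_into_left[OF iso_bij[OF assms(2)]] by blast

lemma equiv_rooted: "equiv rooted rooted_iso"
proof (rule equivI)
  show "rooted_iso \<subseteq> rooted \<times> rooted"
    by (auto simp: rooted_iso_def)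
  show "refl_on rooted rooted_iso"
    using iso_refl by (fastforce simp: refl_on_def rooted_iso_def)
  show "sym rooted_iso"
  proof (rule symI, clarify)
    fix G x H u assume "((G, x), (H, u)) \<in> rooted_iso"
    then obtain \<phi> where *: "iso G H \<phi>" "\<phi> x = u" "(G, x) \<in> rooted" "(H, u) \<in> rooted"
      by (auto simp: rooted_iso_def)
    then have "G \<in> graphs" "x \<in> vertices G" by (auto simp: rooted_def)
    with * obtain \<psi> where "iso H G \<psi>" "\<psi> u = x"
      using iso_inv_ex[of G H \<phi>] by metis
    with * show "((H, u), (G, x)) \<in> rooted_iso"
      by (auto simp: rooted_iso_def)
  qed
  show "trans rooted_iso"
  proof (rule transI, clarify)
    fix G x H u K w
    assume "((G, x), (H, u)) \<in> rooted_iso" "((H, u), (K, w)) \<in> rooted_iso"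
    then obtain \<phi> \<psi> where "iso G H \<phi>" "\<phi> x = u" "iso H K \<psi>" "\<psi> u = w"
        and "(G, x) \<in> rooted" "(K, w) \<in> rooted"
      by (auto simp: rooted_iso_def)
    moreover from this have "iso G K (\<psi> \<circ> \<phi>)" "(\<psi> \<circ> \<phi>) x = w"
      by (auto intro: iso_comp)
    ultimately show "((G, x), (K, w)) \<in> rooted_iso"
      unfolding rooted_iso_def by blast
  qed
qed

lemma equiv_birooted: "equiv birooted birooted_iso"
proof (rule equivI)
  show "birooted_iso \<subseteq> birooted \<times> birooted"
    by (auto simp: birooted_iso_def)
  show "refl_on birooted birooted_iso"
    using iso_refl by (fastforce simp: refl_on_def birooted_iso_def)
  show "sym birooted_iso"
  proof (rule symI, clarify)
    fix G x y H u v assume "((G, x, y), (H, u, v)) \<in> birooted_iso"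
    then obtain \<phi> where *: "iso G H \<phi>" "\<phi> x = u" "\<phi> y = v" "(G, x, y) \<in> birooted" "(H, u, v) \<in> birooted"
      by (auto simp: birooted_iso_def)
    then have "G \<in> graphs" "x \<in> vertices G" "y \<in> vertices G" by (auto simp: birooted_def)
    with * obtain \<psi> where "iso H G \<psi>" "\<psi> u = x" "\<psi> v = y"
      using iso_inv_ex[of G H \<phi>] by metis
    with * show "((H, u, v), (G, x, y)) \<in> birooted_iso"
      by (auto simp: birooted_iso_def)
  qed
  show "trans birooted_iso"
  proof (rule transI, clarify)
    fix G x y H u v K w z
    assume "((G, x, y), (H, u, v)) \<in> birooted_iso" "((H, u, v), (K, w, z)) \<in> birooted_iso"
    then obtain \<phi> \<psi> where "iso G H \<phi>" "\<phi> x = u" "\<phi> y = v" "iso H K \<psi>" "\<psi> u = w" "\<psi> v = z"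
        and "(G, x, y) \<in> birooted" "(K, w, z) \<in> birooted"
      by (auto simp: birooted_iso_def)
    moreover from this have "iso G K (\<psi> \<circ> \<phi>)" "(\<psi> \<circ> \<phi>) x = w" "(\<psi> \<circ> \<phi>) y = z"
      by (auto intro: iso_comp)
    ultimately show "((G, x, y), (K, w, z)) \<in> birooted_iso"
      unfolding birooted_iso_def by blast
  qed
qed

lemma root_class_eq_iff:
  assumes "(G, x) \<in> rooted" "(H, u) \<in> rooted"
  shows "root_class G x = root_class H u \<longleftrightarrow> (\<exists>\<phi>. iso G H \<phi> \<and> \<phi> x = u)"
  using assms eq_equiv_class_iff[OF equiv_rooted assms] by (simp add: rooted_iso_def)

lemma biroot_class_eq_iff:
  assumes "(G, x, y) \<in> birooted" "(H, u, v) \<in> birooted"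
  shows "biroot_class G x y = biroot_class H u v \<longleftrightarrow> (\<exists>\<phi>. iso G H \<phi> \<and> \<phi> x = u \<and> \<phi> y = v)"
  using assms eq_equiv_class_iff[OF equiv_birooted assms] by (simp add: birooted_iso_def)

lemma rooted_classesE:
  assumes "p \<in> rooted_classes"
  obtains G x where "(G, x) \<in> rooted" "p = root_class G x"
  using assms by (auto simp: rooted_classes_def elim!: quotientE)

lemma birooted_classesE:
  assumes "c \<in> birooted_classes"
  obtains G x y where "(G, x, y) \<in> birooted" "c = biroot_class G x y"
  using assms by (auto simp: birooted_classes_def elim!: quotientE)

lemma root_class_in: "(G, x) \<in> rooted \<Longrightarrow> root_class G x \<in> rooted_classes"
  by (auto simp: rooted_classes_def intro: quotientI)

lemma biroot_class_in: "(G, x, y) \<in> birooted \<Longrightarrow> biroot_class G x y \<in> birooted_classes"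
  by (auto simp: birooted_classes_def intro: quotientI)

lemma mem_root_class: "(G, x) \<in> rooted \<Longrightarrow> (G, x) \<in> root_class G x"
  using equiv_class_self[OF equiv_rooted] .

lemma mem_biroot_class: "(G, x, y) \<in> birooted \<Longrightarrow> (G, x, y) \<in> biroot_class G x y"
  using equiv_class_self[OF equiv_birooted] .

lemma rooted_class_memD:
  assumes "p \<in> rooted_classes" "(G, x) \<in> p"
  shows "(G, x) \<in> rooted" "p = root_class G x"
proof -
  obtain H u where H: "(H, u) \<in> rooted" "p = root_class H u"
    using assms(1) by (rule rooted_classesE)
  with assms(2) have *: "((H, u), (G, x)) \<in> rooted_iso" by simp
  then show "(G, x) \<in> rooted" by (simp add: rooted_iso_def)
  show "p = root_class G x" using equiv_class_eq[OF equiv_rooted *] H by simp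
qed

lemma birooted_class_memD:
  assumes "c \<in> birooted_classes" "(G, x, y) \<in> c"
  shows "(G, x, y) \<in> birooted" "c = biroot_class G x y"
proof -
  obtain H u v where H: "(H, u, v) \<in> birooted" "c = biroot_class H u v"
    using assms(1) by (rule birooted_classesE)
  with assms(2) have *: "((H, u, v), (G, x, y)) \<in> birooted_iso" by simp
  then show "(G, x, y) \<in> birooted" by (simp add: birooted_iso_def)
  show "c = biroot_class G x y" using equiv_class_eq[OF equiv_birooted *] H by simp
qed

section \<open>Open sets of rooted and doubly rooted graphs\<close>

text \<open>
  Basic neighborhoods, as sets of representatives: \<open>near r G x\<close> consists of the rooted graphs that
  agree with \<open>(G, x)\<close> up to radius \<open>r\<close>. Openness is tested below with these instead of with the
  cylinders, whose prescribed pattern is an arbitrary graph.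
\<close>

definition near :: "nat \<Rightarrow> 'g \<Rightarrow> nat \<Rightarrow> ('g \<times> nat) set" where
  "near r G x = {(H, u) \<in> rooted. \<exists>\<phi>. iso (nbhd r H u) (nbhd r G x) \<phi> \<and> \<phi> u = x}"

definition binear :: "nat \<Rightarrow> 'g \<Rightarrow> nat \<Rightarrow> nat \<Rightarrow> ('g \<times> nat \<times> nat) set" where
  "binear r G x y = {(H, u, v) \<in> birooted. v \<in> vertices (nbhd r H u) \<and>
     (\<exists>\<phi>. iso (nbhd r H u) (nbhd r G x) \<phi> \<and> \<phi> u = x \<and> \<phi> v = y)}"

lemma nearI:
  "(H, u) \<in> rooted \<Longrightarrow> iso (nbhd r H u) (nbhd r G x) \<phi> \<Longrightarrow> \<phi> u = x \<Longrightarrow> (H, u) \<in> near r G x"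
  by (auto simp: near_def)

lemma nearE:
  assumes "(H, u) \<in> near r G x"
  obtains \<phi> where "(H, u) \<in> rooted" "H \<in> graphs" "u \<in> vertices H"
    "iso (nbhd r H u) (nbhd r G x) \<phi>" "\<phi> u = x"
  using assms by (auto simp: near_def rooted_def)

lemma binearI:
  "(H, u, v) \<in> birooted \<Longrightarrow> v \<in> vertices (nbhd r H u) \<Longrightarrow> iso (nbhd r H u) (nbhd r G x) \<phi> \<Longrightarrow>
   \<phi> u = x \<Longrightarrow> \<phi> v = y \<Longrightarrow> (H, u, v) \<in> binear r G x y"
  by (auto simp: binear_def)

lemma binearE:
  assumes "(H, u, v) \<in> binear r G x y"
  obtains \<phi> where "(H, u, v) \<in> birooted" "H \<in> graphs" "u \<in> vertices H" "v \<in> vertices H"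
    "v \<in> vertices (nbhd r H u)" "iso (nbhd r H u) (nbhd r G x) \<phi>" "\<phi> u = x" "\<phi> v = y"
  using assms by (auto simp: binear_def birooted_def)

lemma near_mono:
  assumes "(G, x) \<in> rooted" "s \<le> r"
  shows "near r G x \<subseteq> near s G x"
proof clarify
  fix H u assume "(H, u) \<in> near r G x"
  then obtain \<phi> where \<phi>: "(H, u) \<in> rooted" "H \<in> graphs" "u \<in> vertices H"
      "iso (nbhd r H u) (nbhd r G x) \<phi>" "\<phi> u = x"
    by (rule nearE)
  then have "iso (nbhd s H u) (nbhd s G x) \<phi>"
    using iso_nbhd_mono[of H G u \<phi> r s] assms by (simp add: rooted_def)
  with \<phi> show "(H, u) \<in> near s G x" by (auto intro: nearI)
qed

text \<open>
  The vertex \<open>\<phi> z\<close> has a preimage in the \<open>s\<close>-neighborhood of \<open>y\<close>, because \<open>\<phi>\<close> restricts to an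
  isomorphism there. Injectivity of \<open>\<phi>\<close> on the large neighborhood identifies this preimage with \<open>z\<close>.
\<close>

lemma nbhd_reflect:
  assumes "G \<in> graphs" "H \<in> graphs" "x \<in> vertices G" "\<phi> x \<in> vertices H"
    and "iso (nbhd r G x) (nbhd r H (\<phi> x)) \<phi>"
    and "y \<in> vertices (nbhd k G x)" "k + s \<le> r"
    and "z \<in> vertices (nbhd r G x)" "\<phi> z \<in> vertices (nbhd s H (\<phi> y))"
  shows "z \<in> vertices (nbhd s G y)"
proof -
  have "iso (nbhd s G y) (nbhd s H (\<phi> y)) \<phi>"
    using iso_nbhd_nbhd assms(1-7) .
  then obtain z' where z': "z' \<in> vertices (nbhd s G y)" "\<phi> z' = \<phi> z"
    using iso_bij assms(9) by (metis bij_betw_def imageE)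
  moreover have "z' \<in> vertices (nbhd r G x)"
    using nbhd_subset_nbhd[OF assms(1,6,7)] z' by blast
  ultimately have "z' = z"
    using iso_bij[OF assms(5)] assms(8) by (auto simp: bij_betw_def inj_on_def)
  with z' show ?thesis by simp
qed

lemma nbhd_reflect_root:
  assumes "G \<in> graphs" "H \<in> graphs" "x \<in> vertices G" "\<phi> x \<in> vertices H"
    and "iso (nbhd r G x) (nbhd r H (\<phi> x)) \<phi>" "s \<le> r"
    and "z \<in> vertices (nbhd r G x)" "\<phi> z \<in> vertices (nbhd s H (\<phi> x))"
  shows "z \<in> vertices (nbhd s G x)"
  using nbhd_reflect[OF assms(1-5), of x 0 s z] root_in_nbhd assms by simp

lemma binear_mono:
  assumes "(G, x, y) \<in> birooted" "s \<le> r" "y \<in> vertices (nbhd s G x)"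
  shows "binear r G x y \<subseteq> binear s G x y"
proof clarify
  fix H u v assume "(H, u, v) \<in> binear r G x y"
  then obtain \<phi> where \<phi>: "(H, u, v) \<in> birooted" "H \<in> graphs" "u \<in> vertices H" "v \<in> vertices H"
      "v \<in> vertices (nbhd r H u)" "iso (nbhd r H u) (nbhd r G x) \<phi>" "\<phi> u = x" "\<phi> v = y"
    by (rule binearE)
  moreover have "iso (nbhd s H u) (nbhd s G x) \<phi>"
    using iso_nbhd_mono[of H G u \<phi> r s] assms \<phi> by (simp add: birooted_def)
  moreover have "v \<in> vertices (nbhd s H u)"
    using nbhd_reflect_root[of H G u \<phi> r s v] assms \<phi> by (simp add: birooted_def)
  ultimately show "(H, u, v) \<in> binear s G x y" by (auto intro: binearI)
qed

text \<open>
  A class in \<open>A\<close> is contained in the cylinder whose pattern is the \<open>r\<close>-neighborhood of its own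
  representative, and the members of this cylinder are the classes of elements of \<open>near r G x\<close>.
\<close>

lemma openin_cylinder_topologyI:
  assumes "A \<subseteq> rooted_classes"
    and "\<And>G x. (G, x) \<in> rooted \<Longrightarrow> root_class G x \<in> A \<Longrightarrow>
      \<exists>r. \<forall>(H, u) \<in> near r G x. root_class H u \<in> A"
  shows "openin cylinder_topology A"
proof (subst openin_subopen, intro ballI)
  fix p assume p: "p \<in> A"
  with assms(1) obtain G x where Gx: "(G, x) \<in> rooted" "p = root_class G x"
    using rooted_classesE by blast
  with assms(2) p obtain r where r: "\<forall>(H, u) \<in> near r G x. root_class H u \<in> A"
    by blast
  let ?C = "cylinder r (nbhd r G x) x"
  have "openin cylinder_topology ?C"
    by (auto simp: cylinder_topology_def intro!: topology_generated_by_Basis)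
  moreover have "p \<in> ?C"
    using Gx mem_root_class[OF Gx(1)] root_class_in[OF Gx(1)] iso_refl[of "nbhd r G x"]
    unfolding cylinder_def by fastforce
  moreover have "?C \<subseteq> A"
  proof
    fix q assume "q \<in> ?C"
    then obtain H u \<phi> where H: "q \<in> rooted_classes" "(H, u) \<in> q" 
        "iso (nbhd r H u) (nbhd r G x) \<phi>" "\<phi> u = x"
      by (auto simp: cylinder_def)
    then have "(H, u) \<in> near r G x"
      using rooted_class_memD[OF H(1,2)] by (auto intro: nearI)
    then show "q \<in> A" using r rooted_class_memD[OF H(1,2)] by auto
  qed
  ultimately show "\<exists>T. openin cylinder_topology T \<and> p \<in> T \<and> T \<subseteq> A" by blast
qed

lemma openin_bicylinder_topologyI:
  assumes "A \<subseteq> birooted_classes"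
    and "\<And>G x y. (G, x, y) \<in> birooted \<Longrightarrow> biroot_class G x y \<in> A \<Longrightarrow>
      \<exists>r. y \<in> vertices (nbhd r G x) \<and> (\<forall>(H, u, v) \<in> binear r G x y. biroot_class H u v \<in> A)"
  shows "openin bicylinder_topology A"
proof (subst openin_subopen, intro ballI)
  fix p assume p: "p \<in> A"
  with assms(1) obtain G x y where Gx: "(G, x, y) \<in> birooted" "p = biroot_class G x y"
    using birooted_classesE by blast
  with assms(2) p obtain r where r: "y \<in> vertices (nbhd r G x)"
      "\<forall>(H, u, v) \<in> binear r G x y. biroot_class H u v \<in> A"
    by blast
  let ?C = "bicylinder r (nbhd r G x) x y"
  have "openin bicylinder_topology ?C"
    by (auto simp: bicylinder_topology_def intro!: topology_generated_by_Basis)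
  moreover have "p \<in> ?C"
    using Gx mem_biroot_class[OF Gx(1)] biroot_class_in[OF Gx(1)] iso_refl[of "nbhd r G x"] r(1)
    unfolding bicylinder_def by fastforce
  moreover have "?C \<subseteq> A"
  proof
    fix q assume "q \<in> ?C"
    then obtain H u v \<phi> where H: "q \<in> birooted_classes" "(H, u, v) \<in> q" "v \<in> vertices (nbhd r H u)"
        "iso (nbhd r H u) (nbhd r G x) \<phi>" "\<phi> u = x" "\<phi> v = y"
      by (auto simp: bicylinder_def)
    then have "(H, u, v) \<in> binear r G x y"
      using birooted_class_memD[OF H(1,2)] by (auto intro: binearI)
    then show "q \<in> A" using r birooted_class_memD[OF H(1,2)] by auto
  qed
  ultimately show "\<exists>T. openin bicylinder_topology T \<and> p \<in> T \<and> T \<subseteq> A" by blast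
qed

lemma cylinder_local:
  assumes "(G, x) \<in> rooted" "root_class G x \<in> cylinder r U w" "(H, u) \<in> near r G x"
  shows "root_class H u \<in> cylinder r U w"
proof -
  obtain G' x' \<theta> where \<theta>: "(G', x') \<in> root_class G x" "iso (nbhd r G' x') U \<theta>" "\<theta> x' = w"
    using assms(2) by (auto simp: cylinder_def)
  then obtain \<eta> where \<eta>: "iso G G' \<eta>" "\<eta> x = x'"
    by (auto simp: rooted_iso_def)
  obtain \<phi> where \<phi>: "(H, u) \<in> rooted" "iso (nbhd r H u) (nbhd r G x) \<phi>" "\<phi> u = x"
    using assms(3) by (rule nearE)
  have "iso (nbhd r G x) (nbhd r G' x') \<eta>"
    using iso_nbhd[of G x G' \<eta> r] \<eta> assms(1) by (auto simp: rooted_def)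
  from iso_comp[OF this \<theta>(2)] have "iso (nbhd r G x) U (\<theta> \<circ> \<eta>)" .
  from iso_comp[OF \<phi>(2) this] have "iso (nbhd r H u) U (\<theta> \<circ> \<eta> \<circ> \<phi>)" .
  moreover have "(\<theta> \<circ> \<eta> \<circ> \<phi>) u = w" using \<phi> \<eta> \<theta> by simp
  ultimately show ?thesis
    using mem_root_class[OF \<phi>(1)] root_class_in[OF \<phi>(1)] unfolding cylinder_def by blast
qed

text \<open>
  A class that lies in a bicylinder may do so through a representative other than \<open>(G, x, y)\<close>; the
  pattern is transported along the isomorphism \<open>\<eta>\<close> between the two. As \<open>\<eta>\<close> is injective on all of
  \<open>G\<close>, the secondary root stays within distance \<open>r\<close> of the principal one.
\<close>

lemma bicylinder_local:
  assumes "(G, x, y) \<in> birooted" "biroot_class G x y \<in> bicylinder r U w z"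
  shows "y \<in> vertices (nbhd r G x)"
    and "(H, u, v) \<in> binear r G x y \<Longrightarrow> biroot_class H u v \<in> bicylinder r U w z"
proof -
  obtain G' x' y' \<theta> where \<theta>: "(G', x', y') \<in> biroot_class G x y" "y' \<in> vertices (nbhd r G' x')"
      "iso (nbhd r G' x') U \<theta>" "\<theta> x' = w" "\<theta> y' = z"
    using assms(2) by (auto simp: bicylinder_def)
  then obtain \<eta> where \<eta>: "iso G G' \<eta>" "\<eta> x = x'" "\<eta> y = y'"
    by (auto simp: birooted_iso_def)
  have G: "G \<in> graphs" "x \<in> vertices G" "y \<in> vertices G"
    using assms(1) by (auto simp: birooted_def)
  have \<eta>': "iso (nbhd r G x) (nbhd r G' x') \<eta>"
    using iso_nbhd[of G x G' \<eta> r] \<eta> G by auto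
  obtain y'' where y'': "y'' \<in> vertices (nbhd r G x)" "\<eta> y'' = y'"
    using iso_bij[OF \<eta>'] \<theta>(2) by (metis bij_betw_def imageE)
  have "y'' = y"
    using iso_bij[OF \<eta>(1)] y'' \<eta> G nbhd_subset[of G x r]
    by (auto simp: bij_betw_def inj_on_def)
  with y'' show "y \<in> vertices (nbhd r G x)" by simp
  assume "(H, u, v) \<in> binear r G x y"
  then obtain \<phi> where \<phi>: "(H, u, v) \<in> birooted" "v \<in> vertices (nbhd r H u)"
      "iso (nbhd r H u) (nbhd r G x) \<phi>" "\<phi> u = x" "\<phi> v = y"
    by (rule binearE)
  from iso_comp[OF \<eta>' \<theta>(3)] have "iso (nbhd r G x) U (\<theta> \<circ> \<eta>)" .
  from iso_comp[OF \<phi>(3) this] have "iso (nbhd r H u) U (\<theta> \<circ> \<eta> \<circ> \<phi>)" .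
  moreover have "(\<theta> \<circ> \<eta> \<circ> \<phi>) u = w" "(\<theta> \<circ> \<eta> \<circ> \<phi>) v = z" using \<phi> \<eta> \<theta> by simp_all
  ultimately show "biroot_class H u v \<in> bicylinder r U w z"
    using mem_biroot_class[OF \<phi>(1)] biroot_class_in[OF \<phi>(1)] \<phi>(2)
    unfolding bicylinder_def by blast
qed

lemma openin_cylinder_topologyD:
  assumes "openin cylinder_topology A"
  shows "A \<subseteq> rooted_classes"
    and "(G, x) \<in> rooted \<Longrightarrow> root_class G x \<in> A \<Longrightarrow>
      \<exists>r. \<forall>(H, u) \<in> near r G x. root_class H u \<in> A"
proof -
  have gen: "generate_topology_on {cylinder r U u | r U u. True} A"
    using assms by (simp add: cylinder_topology_def openin_topology_generated_by_iff)
  show "A \<subseteq> rooted_classes"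
    using gen by induction (auto simp: cylinder_def)
  assume G: "(G, x) \<in> rooted"
  show "\<exists>r. \<forall>(H, u) \<in> near r G x. root_class H u \<in> A" if "root_class G x \<in> A"
    using gen that
  proof induction
    case Empty
    then show ?case by simp
  next
    case (Int A B)
    then obtain r s where "\<forall>(H, u) \<in> near r G x. root_class H u \<in> A"
        "\<forall>(H, u) \<in> near s G x. root_class H u \<in> B"
      by blast
    moreover have "near (max r s) G x \<subseteq> near r G x" "near (max r s) G x \<subseteq> near s G x"
      using near_mono[OF G] by simp_all
    ultimately have "\<forall>(H, u) \<in> near (max r s) G x. root_class H u \<in> A \<inter> B"
      by blast
    then show ?case by blast
  next
    case (UN K)
    then obtain k where k: "k \<in> K" "root_class G x \<in> k" by blast
    from UN.IH[OF this] obtain r where "\<forall>(H, u) \<in> near r G x. root_class H u \<in> k" by blast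
    with k show ?case by blast
  next
    case (Basis C)
    then obtain r U w where "C = cylinder r U w" by blast
    then show ?case using cylinder_local[OF G] Basis(2) by blast
  qed
qed

lemma openin_bicylinder_topologyD:
  assumes "openin bicylinder_topology A"
  shows "A \<subseteq> birooted_classes"
    and "(G, x, y) \<in> birooted \<Longrightarrow> biroot_class G x y \<in> A \<Longrightarrow>
      \<exists>r. y \<in> vertices (nbhd r G x) \<and> (\<forall>(H, u, v) \<in> binear r G x y. biroot_class H u v \<in> A)"
proof -
  have gen: "generate_topology_on {bicylinder r U u v | r U u v. True} A"
    using assms by (simp add: bicylinder_topology_def openin_topology_generated_by_iff)
  show "A \<subseteq> birooted_classes"
    using gen by induction (auto simp: bicylinder_def)
  assume G: "(G, x, y) \<in> birooted"
  show "\<exists>r. y \<in> vertices (nbhd r G x) \<and> (\<forall>(H, u, v) \<in> binear r G x y. biroot_class H u v \<in> A)"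
    if "biroot_class G x y \<in> A"
    using gen that
  proof induction
    case Empty
    then show ?case by simp
  next
    case (Int A B)
    then obtain r s where rs: "y \<in> vertices (nbhd r G x)" "y \<in> vertices (nbhd s G x)"
        "\<forall>(H, u, v) \<in> binear r G x y. biroot_class H u v \<in> A"
        "\<forall>(H, u, v) \<in> binear s G x y. biroot_class H u v \<in> B"
      by blast
    moreover have "binear (max r s) G x y \<subseteq> binear r G x y" "binear (max r s) G x y \<subseteq> binear s G x y"
      using binear_mono[OF G] rs by simp_all
    ultimately have "\<forall>(H, u, v) \<in> binear (max r s) G x y. biroot_class H u v \<in> A \<inter> B"
      by blast
    moreover have "y \<in> vertices (nbhd (max r s) G x)"
      using rs by (cases "r \<le> s") (simp_all add: max_def)
    ultimately show ?case by blast
  next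
    case (UN K)
    then obtain k where k: "k \<in> K" "biroot_class G x y \<in> k" by blast
    from UN.IH[OF this] obtain r where "y \<in> vertices (nbhd r G x)"
      "\<forall>(H, u, v) \<in> binear r G x y. biroot_class H u v \<in> k" by blast
    with k show ?case by blast
  next
    case (Basis C)
    then obtain r U w z where "C = bicylinder r U w z" by blast
    then show ?case using bicylinder_local[OF G] Basis(2) by blast
  qed
qed

section \<open>Exchanging the two roots\<close>

definition swap :: "('g \<times> nat \<times> nat) set \<Rightarrow> ('g \<times> nat \<times> nat) set" where
  "swap c = (\<lambda>(G, x, y). (G, y, x)) ` c"

lemma swap_class:
  "swap (biroot_class G x y) = biroot_class G y x"
  by (force simp: swap_def birooted_iso_def birooted_def)

lemma swap_swap [simp]: "swap (swap c) = c"
  by (simp add: swap_def image_image case_prod_unfold)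

lemma birooted_swap: "(G, y, x) \<in> birooted \<longleftrightarrow> (G, x, y) \<in> birooted"
  by (auto simp: birooted_def)

lemma swap_in: "c \<in> birooted_classes \<Longrightarrow> swap c \<in> birooted_classes"
  by (elim birooted_classesE) (auto simp: swap_class birooted_swap intro: biroot_class_in)

lemma proj_y_swap: "proj_y c = proj_x (swap c)"
  by (simp add: proj_x_def proj_y_def swap_def image_image case_prod_unfold)

lemma mass_y_swap: "mass_y c = mass_x (swap c)"
  by (simp add: mass_x_def mass_y_def swap_def image_image case_prod_unfold)

lemma openin_birooted_classes: "openin bicylinder_topology birooted_classes"
proof (rule openin_bicylinder_topologyI)
  fix G x y assume "(G, x, y) \<in> birooted"
  then have "y \<in> (\<Union>r. vertices (nbhd r G x))"
    using Union_nbhd[of G x] by (simp add: birooted_def)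
  then show "\<exists>r. y \<in> vertices (nbhd r G x) \<and>
      (\<forall>(H, u, v) \<in> binear r G x y. biroot_class H u v \<in> birooted_classes)"
    by (auto simp: binear_def intro: biroot_class_in)
qed simp

lemma open_subset_rooted_classes: "{A. openin cylinder_topology A} \<subseteq> Pow rooted_classes"
  using openin_cylinder_topologyD(1) by blast

lemma open_subset_birooted_classes: "{A. openin bicylinder_topology A} \<subseteq> Pow birooted_classes"
  using openin_bicylinder_topologyD(1) by blast

lemma sets_borel_sets: "sets borel_sets = sigma_sets rooted_classes {A. openin cylinder_topology A}"
  unfolding borel_sets_def by (rule sets_measure_of[OF open_subset_rooted_classes])

lemma space_borel_sets: "space borel_sets = rooted_classes"
  unfolding borel_sets_def by (rule space_measure_of[OF open_subset_rooted_classes])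

lemma sets_biborel_sets: "sets biborel_sets = sigma_sets birooted_classes {A. openin bicylinder_topology A}"
  unfolding biborel_sets_def by (rule sets_measure_of[OF open_subset_birooted_classes])

lemma space_biborel_sets: "space biborel_sets = birooted_classes"
  unfolding biborel_sets_def by (rule space_measure_of[OF open_subset_birooted_classes])

lemma open_in_borel_sets: "openin cylinder_topology A \<Longrightarrow> A \<in> sets borel_sets"
  by (simp add: sets_borel_sets)

lemma open_in_biborel_sets: "openin bicylinder_topology A \<Longrightarrow> A \<in> sets biborel_sets"
  by (simp add: sets_biborel_sets)

text \<open>
  Exchanging the roots is continuous: if \<open>y\<close> is within distance \<open>k\<close> of \<open>x\<close>, then the
  \<open>(k + s)\<close>-neighborhood of \<open>x\<close> contains the \<open>s\<close>-neighborhood of \<open>y\<close>, so agreement around \<open>x\<close> up to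
  radius \<open>k + s\<close> forces agreement around \<open>y\<close> up to radius \<open>s\<close>.
\<close>

lemma measurable_swap: "swap \<in> biborel_sets \<rightarrow>\<^sub>M biborel_sets"
proof (rule measurable_sigma_sets[OF sets_biborel_sets open_subset_birooted_classes])
  show "swap \<in> space biborel_sets \<rightarrow> birooted_classes"
    by (auto simp: space_biborel_sets intro: swap_in)
  fix B assume "B \<in> {A. openin bicylinder_topology A}"
  then have B: "openin bicylinder_topology B" by simp
  have "openin bicylinder_topology (swap -` B \<inter> birooted_classes)"
  proof (rule openin_bicylinder_topologyI)
    fix G x y assume G: "(G, x, y) \<in> birooted" "biroot_class G x y \<in> swap -` B \<inter> birooted_classes"
    then have G': "G \<in> graphs" "x \<in> vertices G" "y \<in> vertices G" "(G, y, x) \<in> birooted"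
      by (auto simp: birooted_def)
    have "biroot_class G y x \<in> B" using G by (simp add: swap_class)
    then obtain s where s: "x \<in> vertices (nbhd s G y)"
        "\<forall>(H, u, v) \<in> binear s G y x. biroot_class H u v \<in> B"
      using openin_bicylinder_topologyD(2)[OF B G'(4)] by blast
    obtain k where k: "y \<in> vertices (nbhd k G x)"
      using Union_nbhd[OF G'(1,2)] G'(3) by blast
    have "biroot_class H u v \<in> swap -` B \<inter> birooted_classes"
      if "(H, u, v) \<in> binear (k + s) G x y" for H u v
    proof -
      obtain \<phi> where H: "(H, u, v) \<in> birooted" "H \<in> graphs" "u \<in> vertices H" "v \<in> vertices H"
          "v \<in> vertices (nbhd (k + s) H u)" "iso (nbhd (k + s) H u) (nbhd (k + s) G x) \<phi>"
          "\<phi> u = x" "\<phi> v = y"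
        using \<open>(H, u, v) \<in> binear (k + s) G x y\<close> by (rule binearE)
      have v: "v \<in> vertices (nbhd k H u)"
        using nbhd_reflect_root[of H G u \<phi> "k + s" k v] H G' k by simp
      have "iso (nbhd s H v) (nbhd s G y) \<phi>"
        using iso_nbhd_nbhd[of H G u \<phi> "k + s" v k s] H G' v by simp
      moreover have "u \<in> vertices (nbhd s H v)"
        using nbhd_reflect[of H G u \<phi> "k + s" v k s u] H G' v s(1) root_in_nbhd[of H u] by simp
      ultimately have "(H, v, u) \<in> binear s G y x"
        using H by (auto intro: binearI simp: birooted_swap)
      then show ?thesis
        using s(2) H(1) by (auto simp: swap_class intro: biroot_class_in)
    qed
    moreover have "y \<in> vertices (nbhd (k + s) G x)"
      using nbhd_mono[OF G'(1,2), of k "k + s"] k by auto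
    ultimately show "\<exists>r. y \<in> vertices (nbhd r G x) \<and>
        (\<forall>(H, u, v) \<in> binear r G x y. biroot_class H u v \<in> swap -` B \<inter> birooted_classes)"
      by blast
  qed simp
  then show "swap -` B \<inter> space biborel_sets \<in> sets biborel_sets"
    by (simp add: space_biborel_sets open_in_biborel_sets)
qed

section \<open>Fibers and counting measure\<close>

lemma proj_x_class:
  assumes "(G, x, y) \<in> birooted"
  shows "proj_x (biroot_class G x y) = root_class G x"
proof -
  have "root_class H u = root_class G x" if "(H, u, v) \<in> biroot_class G x y" for H u v
  proof -
    have "(H, u) \<in> rooted" "(G, x) \<in> rooted" "\<exists>\<phi>. iso G H \<phi> \<and> \<phi> x = u"
      using that by (auto simp: birooted_iso_def rooted_def birooted_def)
    then show ?thesis using root_class_eq_iff by blast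
  qed
  then have "rooted_iso `` {q} = root_class G x" if "q \<in> (\<lambda>(G, x, y). (G, x)) ` biroot_class G x y" for q
    using that by fast
  moreover have "(\<lambda>(G, x, y). (G, x)) ` biroot_class G x y \<noteq> {}"
    using mem_biroot_class[OF assms] by blast
  ultimately have "(\<Union>q \<in> (\<lambda>(G, x, y). (G, x)) ` biroot_class G x y. rooted_iso `` {q}) = root_class G x"
    by (rule SUP_eq_const[rotated])
  then show ?thesis
    unfolding proj_x_def by (subst Image_eq_UN)
qed

lemma fiber_x_class:
  assumes "(G, x) \<in> rooted"
  shows "fiber_x (root_class G x) = biroot_class G x ` vertices G"
proof (intro equalityI subsetI)
  fix c assume c: "c \<in> fiber_x (root_class G x)"
  then obtain H u v where H: "(H, u, v) \<in> birooted" "c = biroot_class H u v"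
    by (auto simp: fiber_x_def elim: birooted_classesE)
  then have H': "(H, u) \<in> rooted" by (auto simp: birooted_def rooted_def)
  have "root_class H u = root_class G x"
    using c H proj_x_class by (simp add: fiber_x_def)
  then obtain \<phi> where \<phi>: "iso H G \<phi>" "\<phi> u = x"
    using root_class_eq_iff[OF H' assms] by blast
  moreover have "\<phi> v \<in> vertices G"
    using iso_bij[OF \<phi>(1)] H by (auto simp: bij_betw_def birooted_def)
  moreover from this have "(G, x, \<phi> v) \<in> birooted"
    using assms by (simp add: birooted_def rooted_def)
  ultimately have "c = biroot_class G x (\<phi> v)"
    using biroot_class_eq_iff[OF H(1)] H(2) by blast
  then show "c \<in> biroot_class G x ` vertices G" using \<open>\<phi> v \<in> vertices G\<close> by blast
next
  fix c assume "c \<in> biroot_class G x ` vertices G"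
  then show "c \<in> fiber_x (root_class G x)"
    using assms by (auto simp: fiber_x_def rooted_def birooted_def proj_x_class intro!: biroot_class_in)
qed

text \<open>
  The orbits of the stabilizer of \<open>x\<close> are the sets of secondary roots that give the same class over
  \<open>(G, x)\<close>. Thus the orbit sizes are the sizes of the preimages under \<open>y \<mapsto> biroot_class G x y\<close>.
\<close>

lemma stabilizer_orbit_eq:
  assumes "(G, x, y) \<in> birooted"
  shows "stabilizer_orbit G x y = {z \<in> vertices G. biroot_class G x z = biroot_class G x y}"
proof -
  have eq: "biroot_class G x y = biroot_class G x z \<longleftrightarrow> (\<exists>\<phi>. iso G G \<phi> \<and> \<phi> x = x \<and> \<phi> y = z)"
    if "z \<in> vertices G" for z
  proof (rule biroot_class_eq_iff[OF assms])
    show "(G, x, z) \<in> birooted" using that assms unfolding birooted_def by blast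
  qed
  have "y \<in> vertices G" using assms unfolding birooted_def by blast
  then have mem: "\<phi> y \<in> vertices G" if "iso G G \<phi>" for \<phi>
    using bij_betwE[OF iso_bij[OF that]] by blast
  show ?thesis
  proof (intro equalityI subsetI)
    fix z assume "z \<in> stabilizer_orbit G x y"
    then obtain \<phi> where \<phi>: "iso G G \<phi>" "\<phi> x = x" "\<phi> y = z"
      unfolding stabilizer_orbit_def by blast
    then show "z \<in> {z \<in> vertices G. biroot_class G x z = biroot_class G x y}"
      using mem[OF \<phi>(1)] eq[of z] by blast
  next
    fix z assume "z \<in> {z \<in> vertices G. biroot_class G x z = biroot_class G x y}"
    then show "z \<in> stabilizer_orbit G x y"
      unfolding stabilizer_orbit_def using eq[of z] by blast
  qed
qed

text \<open>
  Automorphisms fixing \<open>x\<close> preserve the neighborhoods of \<open>x\<close>. Finiteness of the orbits matters because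
  \<^const>\<open>card\<close> would otherwise assign an infinite orbit the mass 0.
\<close>

lemma finite_stabilizer_orbit:
  assumes "(G, x, y) \<in> birooted"
  shows "finite (stabilizer_orbit G x y)"
proof -
  have G: "G \<in> graphs" "x \<in> vertices G" "y \<in> vertices G"
    using assms by (auto simp: birooted_def)
  obtain r where r: "y \<in> vertices (nbhd r G x)"
    using Union_nbhd[OF G(1,2)] G(3) by blast
  have "stabilizer_orbit G x y \<subseteq> vertices (nbhd r G x)"
    using iso_bij[OF iso_nbhd[OF G(1,2)]] r unfolding stabilizer_orbit_def bij_betw_def by force
  then show ?thesis using finite_nbhd[OF G(1)] finite_subset by blast
qed

lemma mass_x_class:
  assumes "(G, x, y) \<in> birooted"
  shows "mass_x (biroot_class G x y) = card {z \<in> vertices G. biroot_class G x z = biroot_class G x y}"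
proof -
  have *: "card {w \<in> vertices H. biroot_class H u w = biroot_class H u v} =
      card {z \<in> vertices G. biroot_class G x z = biroot_class G x y}"
    if H: "(H, u, v) \<in> biroot_class G x y" for H u v
  proof -
    obtain \<phi> where \<phi>: "(H, u, v) \<in> birooted" "iso G H \<phi>" "\<phi> x = u" "\<phi> y = v"
      using H by (auto simp: birooted_iso_def)
    have "biroot_class H u (\<phi> z) = biroot_class G x z" if "z \<in> vertices G" for z
    proof -
      have "\<phi> z \<in> vertices H" using iso_bij[OF \<phi>(2)] that by (auto simp: bij_betw_def)
      then have "(G, x, z) \<in> birooted" "(H, u, \<phi> z) \<in> birooted"
        using assms \<phi>(1) that by (auto simp: birooted_def)
      then show ?thesis using biroot_class_eq_iff \<phi> by metis
    qed
    moreover have "y \<in> vertices G" using assms by (simp add: birooted_def)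
    ultimately have "bij_betw \<phi> {z \<in> vertices G. biroot_class G x z = biroot_class G x y}
        {w \<in> vertices H. biroot_class H u w = biroot_class H u v}"
      using \<phi>(4) by (intro bij_betw_Collect[OF iso_bij[OF \<phi>(2)]]) metis
    from bij_betw_same_card[OF this] show ?thesis by simp
  qed
  have "mass_x (biroot_class G x y) = (\<lambda>(G, x, y). card (stabilizer_orbit G x y)) (G, x, y)"
    unfolding mass_x_def
  proof (rule the_elem_image_unique)
    show "biroot_class G x y \<noteq> {}" using mem_biroot_class[OF assms] by blast
    fix q assume q: "q \<in> biroot_class G x y"
    obtain H u v where [simp]: "q = (H, u, v)" by (cases q)
    have "(H, u, v) \<in> birooted" using q by (auto simp: birooted_iso_def)
    then show "(\<lambda>(G, x, y). card (stabilizer_orbit G x y)) q =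
        (\<lambda>(G, x, y). card (stabilizer_orbit G x y)) (G, x, y)"
      using *[of H u v] q assms by (simp add: stabilizer_orbit_eq)
  qed
  then show ?thesis using assms by (simp add: stabilizer_orbit_eq)
qed

definition fiber_mass_x :: "('g \<times> nat) set \<Rightarrow> ('g \<times> nat \<times> nat) set set \<Rightarrow> ennreal" where
  "fiber_mass_x p B = emeasure (point_measure (fiber_x p) (\<lambda>c. of_nat (mass_x c))) (B \<inter> fiber_x p)"

definition fiber_mass_y :: "('g \<times> nat) set \<Rightarrow> ('g \<times> nat \<times> nat) set set \<Rightarrow> ennreal" where
  "fiber_mass_y p B = emeasure (point_measure (fiber_y p) (\<lambda>c. of_nat (mass_y c))) (B \<inter> fiber_y p)"

text \<open>
  The key reformulation: the measure on the fiber over \<open>(G, x)\<close>, which weights each class by an orbit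
  size, is the image of the counting measure on the vertices of \<open>G\<close>. The vertices split into the
  orbits, one for each point of the fiber, and the size of the orbit is the weight of that point.
  In this form the automorphism group, which changes when the labels are forgotten, no longer appears.
\<close>

lemma fiber_mass_x_class:
  assumes "(G, x) \<in> rooted"
  shows "fiber_mass_x (root_class G x) B = emeasure (count_space UNIV) {y \<in> vertices G. biroot_class G x y \<in> B}"
proof -
  let ?I = "B \<inter> fiber_x (root_class G x)"
  let ?O = "\<lambda>c. {y \<in> vertices G. biroot_class G x y = c}"
  have "{y \<in> vertices G. biroot_class G x y \<in> B} = (\<Union>c \<in> ?I. ?O c)"
    by (auto simp: fiber_x_class[OF assms])
  then have "emeasure (count_space UNIV) {y \<in> vertices G. biroot_class G x y \<in> B} =
      emeasure (count_space UNIV) (\<Union>c \<in> ?I. ?O c)"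
    by (rule arg_cong)
  also have "\<dots> = (\<integral>\<^sup>+ c. emeasure (count_space UNIV) (?O c) \<partial>count_space ?I)"
    by (rule emeasure_UN_countable) (auto simp: fiber_x_class[OF assms] disjoint_family_on_def)
  also have "\<dots> = (\<integral>\<^sup>+ c. of_nat (mass_x c) \<partial>count_space ?I)"
  proof (rule nn_integral_cong)
    fix c assume "c \<in> space (count_space ?I)"
    then have "c \<in> biroot_class G x ` vertices G"
      unfolding space_count_space fiber_x_class[OF assms] by (rule IntD2)
    then obtain y where y: "y \<in> vertices G" "c = biroot_class G x y"
      by blast
    then have G: "(G, x, y) \<in> birooted" using assms by (simp add: birooted_def rooted_def)
    have "finite (?O c)"
      using finite_stabilizer_orbit[OF G] unfolding stabilizer_orbit_eq[OF G] y(2) .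
    then show "emeasure (count_space UNIV) (?O c) = of_nat (mass_x c)"
      unfolding y(2) mass_x_class[OF G] by (simp add: emeasure_count_space_finite)
  qed
  also have "\<dots> = fiber_mass_x (root_class G x) B"
    unfolding fiber_mass_x_def by (rule emeasure_point_measure_nn_integral[symmetric]) simp
  finally show ?thesis by simp
qed

lemma fiber_mass_y_eq:
  "fiber_mass_y p B = fiber_mass_x p (swap -` B \<inter> birooted_classes)"
proof -
  have "bij_betw swap (B \<inter> fiber_y p) ((swap -` B \<inter> birooted_classes) \<inter> fiber_x p)"
    by (rule bij_betwI[where g = swap]) (auto simp: fiber_x_def fiber_y_def proj_y_swap swap_in)
  from nn_integral_bij_count_space[OF this, of "\<lambda>c. of_nat (mass_x c)"]
  show ?thesis
    unfolding fiber_mass_x_def fiber_mass_y_def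
    by (subst (1 2) emeasure_point_measure_nn_integral) (auto simp: mass_y_swap)
qed

lemma fiber_mass_y_class:
  assumes "(G, x) \<in> rooted"
  shows "fiber_mass_y (root_class G x) B = emeasure (count_space UNIV) {y \<in> vertices G. biroot_class G y x \<in> B}"
proof -
  have "{y \<in> vertices G. biroot_class G x y \<in> swap -` B \<inter> birooted_classes} =
      {y \<in> vertices G. biroot_class G y x \<in> B}"
    using assms by (auto simp: swap_class rooted_def birooted_def intro!: biroot_class_in)
  then show ?thesis by (simp add: fiber_mass_y_eq fiber_mass_x_class[OF assms])
qed

section \<open>Measurability of the mass of a fiber\<close>

text \<open>
  The mass of a fiber may be infinite, so complements cannot be handled directly. Restricting to
  secondary roots within distance \<open>r\<close> makes all masses finite. The choice of a representative of
  \<open>p\<close> does not affect the value.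
\<close>

definition local_mass :: "nat \<Rightarrow> ('g \<times> nat) set \<Rightarrow> ('g \<times> nat \<times> nat) set set \<Rightarrow> ennreal" where
  "local_mass r p B = (case SOME q. q \<in> p of (G, x) \<Rightarrow>
     emeasure (count_space UNIV) {y \<in> vertices (nbhd r G x). biroot_class G x y \<in> B})"

lemma local_mass_class:
  assumes G: "(G, x) \<in> rooted"
  shows "local_mass r (root_class G x) B = 
    of_nat (card {y \<in> vertices (nbhd r G x). biroot_class G x y \<in> B})"
proof -
  obtain H u where H: "(SOME q. q \<in> root_class G x) = (H, u)" by (cases "SOME q. q \<in> root_class G x")
  have "(SOME q. q \<in> root_class G x) \<in> root_class G x"
    using mem_root_class[OF G] by (rule someI)
  then obtain \<phi> where \<phi>: "(H, u) \<in> rooted" "iso G H \<phi>" "\<phi> x = u"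
    unfolding H by (auto simp: rooted_iso_def)
  have G': "G \<in> graphs" "x \<in> vertices G" using G by (auto simp: rooted_def)
  have \<phi>': "iso (nbhd r G x) (nbhd r H u) \<phi>" using iso_nbhd[OF G' \<phi>(2), of r] \<phi>(3) by simp
  have "biroot_class H u (\<phi> z) = biroot_class G x z" if "z \<in> vertices (nbhd r G x)" for z
  proof -
    have "z \<in> vertices G" using that nbhd_subset[OF G'] by blast
    moreover from this have "\<phi> z \<in> vertices H" using iso_bij[OF \<phi>(2)] by (auto simp: bij_betw_def)
    ultimately have "(G, x, z) \<in> birooted" "(H, u, \<phi> z) \<in> birooted"
      using G' \<phi>(1) by (auto simp: birooted_def rooted_def)
    then show ?thesis using biroot_class_eq_iff \<phi> by metis
  qed
  then have "bij_betw \<phi> {y \<in> vertices (nbhd r G x). biroot_class G x y \<in> B}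
      {v \<in> vertices (nbhd r H u). biroot_class H u v \<in> B}"
    by (intro bij_betw_Collect[OF iso_bij[OF \<phi>']]) simp
  moreover have "H \<in> graphs" using \<phi>(1) by (auto simp: rooted_def)
  ultimately show ?thesis
    unfolding local_mass_def H
    by (simp add: emeasure_count_space_finite finite_nbhd bij_betw_same_card)
qed

text \<open>
  Lower semicontinuity: finitely many vertices \<open>y\<close> near \<open>x\<close> give classes in the open set \<open>B\<close>, and each
  of these memberships is decided within some radius \<open>s y\<close>. A rooted graph that agrees with \<open>(G, x)\<close>
  up to the maximum \<open>R\<close> of these radii has at least as many such vertices.
\<close>

lemma openin_local_mass_ge:
  assumes B: "openin bicylinder_topology B"
  shows "openin cylinder_topology {p \<in> rooted_classes. a \<le> local_mass r p B}"
proof (rule openin_cylinder_topologyI)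
  fix G x assume G: "(G, x) \<in> rooted" "root_class G x \<in> {p \<in> rooted_classes. a \<le> local_mass r p B}"
  then have G': "G \<in> graphs" "x \<in> vertices G" by (auto simp: rooted_def)
  define Y where "Y = {y \<in> vertices (nbhd r G x). biroot_class G x y \<in> B}"
  have fin: "finite Y" using finite_nbhd[OF G'(1)] by (simp add: Y_def)
  have "\<exists>s. y \<in> vertices (nbhd s G x) \<and> (\<forall>(H, u, v) \<in> binear s G x y. biroot_class H u v \<in> B)"
    if "y \<in> Y" for y
  proof (rule openin_bicylinder_topologyD(2)[OF B])
    show "(G, x, y) \<in> birooted"
      using that G' nbhd_subset[OF G'] by (auto simp: Y_def birooted_def)
    show "biroot_class G x y \<in> B" using that by (simp add: Y_def)
  qed
  then obtain s where s: "\<And>y. y \<in> Y \<Longrightarrow> y \<in> vertices (nbhd (s y) G x)"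
      "\<And>y. y \<in> Y \<Longrightarrow> \<forall>(H, u, v) \<in> binear (s y) G x y. biroot_class H u v \<in> B"
    by metis
  \<comment> \<open>Including \<open>r\<close> itself makes every vertex of the \<open>r\<close>-neighborhood visible, even if \<open>Y\<close> is empty.\<close>
  define R where "R = Max (insert r (s ` Y))"
  have R: "r \<le> R" "\<And>y. y \<in> Y \<Longrightarrow> s y \<le> R" using fin by (auto simp: R_def)
  have "root_class H u \<in> {p \<in> rooted_classes. a \<le> local_mass r p B}" if "(H, u) \<in> near R G x" for H u
  proof -
    obtain \<phi> where H: "(H, u) \<in> rooted" "H \<in> graphs" "u \<in> vertices H"
        "iso (nbhd R H u) (nbhd R G x) \<phi>" "\<phi> u = x"
      using \<open>(H, u) \<in> near R G x\<close> by (rule nearE)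
    have iso: "iso (nbhd t H u) (nbhd t G x) \<phi>" if "t \<le> R" for t
      using iso_nbhd_mono[of H G u \<phi> R t] H G' that by simp
    let ?Z = "{v \<in> vertices (nbhd r H u). biroot_class H u v \<in> B}"
    have "Y \<subseteq> \<phi> ` ?Z"
    proof
      fix y assume y: "y \<in> Y"
      then obtain v where v: "v \<in> vertices (nbhd r H u)" "y = \<phi> v"
        using iso_bij[OF iso[OF R(1)]] by (auto simp: bij_betw_def Y_def)
      have vR: "v \<in> vertices (nbhd R H u)" using nbhd_mono[OF H(2,3) R(1)] v by blast
      have "(H, u, v) \<in> binear (s y) G x y"
      proof (rule binearI)
        show "(H, u, v) \<in> birooted"
          using H nbhd_subset[OF H(2,3)] v by (auto simp: birooted_def)
        show "v \<in> vertices (nbhd (s y) H u)"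
          using nbhd_reflect_root[of H G u \<phi> R "s y" v] H G' R(2)[OF y] s(1)[OF y] v vR by simp
      qed (use iso[OF R(2)[OF y]] H v in auto)
      then have "biroot_class H u v \<in> B" using s(2)[OF y] by auto
      then show "y \<in> \<phi> ` ?Z" using v by blast
    qed
    then have "card Y \<le> card ?Z"
      by (intro surj_card_le[of _ _ \<phi>]) (simp_all add: finite_nbhd[OF H(2)])
    then have "local_mass r (root_class G x) B \<le> local_mass r (root_class H u) B"
      by (simp add: local_mass_class[OF G(1)] local_mass_class[OF H(1)] Y_def)
    then show ?thesis using G(2) root_class_in[OF H(1)] by auto
  qed
  then show "\<exists>r'. \<forall>(H, u) \<in> near r' G x. root_class H u \<in> {p \<in> rooted_classes. a \<le> local_mass r p B}"
    by blast
qed simp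

lemma measurable_local_mass_open:
  assumes "openin bicylinder_topology B"
  shows "(\<lambda>p. local_mass r p B) \<in> borel_measurable borel_sets"
  by (rule borel_measurableI_ge)
    (simp add: space_borel_sets open_in_borel_sets openin_local_mass_ge assms)

lemma local_mass_Compl:
  assumes "p \<in> rooted_classes" "B \<subseteq> birooted_classes"
  shows "local_mass r p (birooted_classes - B) = local_mass r p birooted_classes - local_mass r p B"
proof -
  obtain G x where G: "(G, x) \<in> rooted" "p = root_class G x" using assms(1) by (rule rooted_classesE)
  let ?Y = "\<lambda>B. {y \<in> vertices (nbhd r G x). biroot_class G x y \<in> B}"
  have fin: "finite (?Y B)" for B using finite_nbhd G by (auto simp: rooted_def)
  have "?Y (birooted_classes - B) = ?Y birooted_classes - ?Y B" by auto
  moreover have sub: "?Y B \<subseteq> ?Y birooted_classes" using assms(2) by auto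
  ultimately have "card (?Y (birooted_classes - B)) = card (?Y birooted_classes) - card (?Y B)"
    using fin by (simp add: card_Diff_subset)
  moreover have "card (?Y B) \<le> card (?Y birooted_classes)" using sub fin by (intro card_mono)
  ultimately have "card (?Y birooted_classes) = card (?Y B) + card (?Y (birooted_classes - B))"
    by simp
  then show ?thesis unfolding G local_mass_class[OF G(1)] by (simp add: ennreal_add_diff_cancel_left)
qed

lemma local_mass_UN:
  assumes "disjoint_family A" "p \<in> rooted_classes"
  shows "local_mass r p (\<Union>i. A i) = (\<Sum>i. local_mass r p (A i))"
proof -
  obtain G x where G: "(SOME q. q \<in> p) = (G, x)" by (cases "SOME q. q \<in> p")
  let ?Y = "\<lambda>B. {y \<in> vertices (nbhd r G x). biroot_class G x y \<in> B}"
  have "(\<Sum>i. emeasure (count_space UNIV) (?Y (A i))) = emeasure (count_space UNIV) (\<Union>i. ?Y (A i))"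
    using assms(1) by (intro suminf_emeasure) (auto simp: disjoint_family_on_def)
  moreover have "(\<Union>i. ?Y (A i)) = ?Y (\<Union>i. A i)" by auto
  ultimately show ?thesis by (simp add: local_mass_def G)
qed

text \<open>
  A Dynkin argument. Open sets are closed under intersection and generate the Borel sets; on them
  measurability is lower semicontinuity, and it passes to complements because the masses are finite.
\<close>

lemma measurable_local_mass:
  assumes "B \<in> sets biborel_sets"
  shows "(\<lambda>p. local_mass r p B) \<in> borel_measurable borel_sets"
proof -
  have "Int_stable {A. openin bicylinder_topology A}"
    by (auto simp: Int_stable_def)
  moreover note open_subset_birooted_classes
  moreover have "B \<in> sigma_sets birooted_classes {A. openin bicylinder_topology A}"
    using assms by (simp add: sets_biborel_sets)
  ultimately show ?thesis
  proof (induction rule: sigma_sets_induct_disjoint)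
    case (basic A)
    then show ?case by (simp add: measurable_local_mass_open)
  next
    case empty
    show ?case by (simp add: measurable_local_mass_open)
  next
    case (compl A)
    then have "A \<subseteq> birooted_classes"
      using sigma_sets_into_sp[OF open_subset_birooted_classes] by blast
    moreover have "(\<lambda>p. local_mass r p birooted_classes) \<in> borel_measurable borel_sets"
      by (rule measurable_local_mass_open[OF openin_birooted_classes])
    then have "(\<lambda>p. local_mass r p birooted_classes - local_mass r p A) \<in> borel_measurable borel_sets"
      using compl(2) by measurable
    ultimately show ?case
      by (subst measurable_cong[where g = "\<lambda>p. local_mass r p birooted_classes - local_mass r p A"])
        (simp_all add: space_borel_sets local_mass_Compl)
  next
    case (union A)
    have "(\<lambda>p. \<Sum>i. local_mass r p (A i)) \<in> borel_measurable borel_sets"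
      using union(3) by measurable
    then show ?case
      by (subst measurable_cong[where g = "\<lambda>p. \<Sum>i. local_mass r p (A i)"])
        (simp_all add: space_borel_sets local_mass_UN[OF union(1)])
  qed
qed

lemma fiber_mass_x_eq_SUP:
  assumes "p \<in> rooted_classes"
  shows "fiber_mass_x p B = (SUP r. local_mass r p B)"
proof -
  obtain G x where G: "(G, x) \<in> rooted" "p = root_class G x" using assms by (rule rooted_classesE)
  then have G': "G \<in> graphs" "x \<in> vertices G" by (auto simp: rooted_def)
  let ?Y = "\<lambda>r. {y \<in> vertices (nbhd r G x). biroot_class G x y \<in> B}"
  have "(SUP r. local_mass r p B) = (SUP r. emeasure (count_space UNIV) (?Y r))"
    by (simp add: G(2) local_mass_class[OF G(1)] emeasure_count_space_finite finite_nbhd G')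
  also have "\<dots> = emeasure (count_space UNIV) (\<Union>r. ?Y r)"
    using nbhd_mono[OF G'] by (intro SUP_emeasure_incseq) (auto simp: incseq_def)
  finally have "(SUP r. local_mass r p B) = emeasure (count_space UNIV) (\<Union>r. ?Y r)" .
  moreover have "(\<Union>r. ?Y r) = {y \<in> vertices G. biroot_class G x y \<in> B}"
    using Union_nbhd[OF G'] by blast
  ultimately show ?thesis by (simp add: G(2) fiber_mass_x_class[OF G(1)])
qed

lemma measurable_fiber_mass_x:
  assumes "B \<in> sets biborel_sets"
  shows "(\<lambda>p. fiber_mass_x p B) \<in> borel_measurable borel_sets"
proof -
  have "(\<lambda>p. SUP r. local_mass r p B) \<in> borel_measurable borel_sets"
    using measurable_local_mass[OF assms] by measurable
  then show ?thesis
    by (subst measurable_cong[where g = "\<lambda>p. SUP r. local_mass r p B"])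
      (simp_all add: space_borel_sets fiber_mass_x_eq_SUP)
qed

lemma measurable_fiber_mass_y:
  assumes "B \<in> sets biborel_sets"
  shows "(\<lambda>p. fiber_mass_y p B) \<in> borel_measurable borel_sets"
  unfolding fiber_mass_y_eq
  using measurable_fiber_mass_x measurable_sets[OF measurable_swap assms]
  by (simp add: space_biborel_sets)

section \<open>The two lifts of a measure\<close>

text \<open>
  The set function that defines the lift is countably additive, by monotone convergence and the
  measurability of the fiber masses. Without this, equality of the two lifts would carry no
  information, since \<^const>\<open>measure_of\<close> turns a set function that is not a measure into the zero
  measure.
\<close>

lemma emeasure_lift_x:
  assumes "sets \<mu> = sets borel_sets" "B \<in> sets biborel_sets"
  shows "emeasure (lift_x \<mu>) B = (\<integral>\<^sup>+ p. fiber_mass_x p B \<partial>\<mu>)"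
  unfolding lift_x_def fiber_mass_x_def[symmetric]
proof (rule emeasure_measure_of_sigma)
  show "sigma_algebra birooted_classes (sets biborel_sets)"
    using sets.sigma_algebra_axioms[of biborel_sets] by (simp add: space_biborel_sets)
  show "positive (sets biborel_sets) (\<lambda>B. \<integral>\<^sup>+ p. fiber_mass_x p B \<partial>\<mu>)"
    by (simp add: positive_def fiber_mass_x_def)
  show "countably_additive (sets biborel_sets) (\<lambda>B. \<integral>\<^sup>+ p. fiber_mass_x p B \<partial>\<mu>)"
  proof (rule countably_additiveI)
    fix A :: "nat \<Rightarrow> ('g \<times> nat \<times> nat) set set"
    assume A: "range A \<subseteq> sets biborel_sets" "disjoint_family A"
    have "(\<Sum>i. fiber_mass_x p (A i)) = fiber_mass_x p (\<Union>i. A i)" for p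
      unfolding fiber_mass_x_def using A(2)
      by (subst suminf_emeasure) (auto simp: sets_point_measure disjoint_family_on_def)
    moreover have "(\<lambda>p. fiber_mass_x p (A i)) \<in> borel_measurable \<mu>" for i
      using A(1) measurable_fiber_mass_x[of "A i"] measurable_cong_sets[OF assms(1) refl] by auto
    ultimately show "(\<Sum>i. \<integral>\<^sup>+ p. fiber_mass_x p (A i) \<partial>\<mu>) = (\<integral>\<^sup>+ p. fiber_mass_x p (\<Union>i. A i) \<partial>\<mu>)"
      by (subst nn_integral_suminf[symmetric]) simp_all
  qed
qed (rule assms(2))

lemma emeasure_lift_y:
  assumes "sets \<mu> = sets borel_sets" "B \<in> sets biborel_sets"
  shows "emeasure (lift_y \<mu>) B = (\<integral>\<^sup>+ p. fiber_mass_y p B \<partial>\<mu>)"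
  unfolding lift_y_def fiber_mass_y_def[symmetric]
proof (rule emeasure_measure_of_sigma)
  show "sigma_algebra birooted_classes (sets biborel_sets)"
    using sets.sigma_algebra_axioms[of biborel_sets] by (simp add: space_biborel_sets)
  show "positive (sets biborel_sets) (\<lambda>B. \<integral>\<^sup>+ p. fiber_mass_y p B \<partial>\<mu>)"
    by (simp add: positive_def fiber_mass_y_def)
  show "countably_additive (sets biborel_sets) (\<lambda>B. \<integral>\<^sup>+ p. fiber_mass_y p B \<partial>\<mu>)"
  proof (rule countably_additiveI)
    fix A :: "nat \<Rightarrow> ('g \<times> nat \<times> nat) set set"
    assume A: "range A \<subseteq> sets biborel_sets" "disjoint_family A"
    have "(\<Sum>i. fiber_mass_y p (A i)) = fiber_mass_y p (\<Union>i. A i)" for p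
      unfolding fiber_mass_y_def using A(2)
      by (subst suminf_emeasure) (auto simp: sets_point_measure disjoint_family_on_def)
    moreover have "(\<lambda>p. fiber_mass_y p (A i)) \<in> borel_measurable \<mu>" for i
      using A(1) measurable_fiber_mass_y[of "A i"] measurable_cong_sets[OF assms(1) refl] by auto
    ultimately show "(\<Sum>i. \<integral>\<^sup>+ p. fiber_mass_y p (A i) \<partial>\<mu>) = (\<integral>\<^sup>+ p. fiber_mass_y p (\<Union>i. A i) \<partial>\<mu>)"
      by (subst nn_integral_suminf[symmetric]) simp_all
  qed
qed (rule assms(2))

lemma lift_x_eq_lift_y_iff:
  assumes "sets \<mu> = sets borel_sets"
  shows "lift_x \<mu> = lift_y \<mu> \<longleftrightarrow>
    (\<forall>B \<in> sets biborel_sets. (\<integral>\<^sup>+ p. fiber_mass_x p B \<partial>\<mu>) = (\<integral>\<^sup>+ p. fiber_mass_y p B \<partial>\<mu>))"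
proof
  assume "lift_x \<mu> = lift_y \<mu>"
  then show "\<forall>B \<in> sets biborel_sets. (\<integral>\<^sup>+ p. fiber_mass_x p B \<partial>\<mu>) = (\<integral>\<^sup>+ p. fiber_mass_y p B \<partial>\<mu>)"
    using emeasure_lift_x[OF assms] emeasure_lift_y[OF assms] by metis
next
  assume *: "\<forall>B \<in> sets biborel_sets. (\<integral>\<^sup>+ p. fiber_mass_x p B \<partial>\<mu>) = (\<integral>\<^sup>+ p. fiber_mass_y p B \<partial>\<mu>)"
  have "sigma_algebra birooted_classes (sets biborel_sets)"
    using sets.sigma_algebra_axioms[of biborel_sets] by (simp add: space_biborel_sets)
  then show "lift_x \<mu> = lift_y \<mu>"
    unfolding lift_x_def lift_y_def fiber_mass_x_def[symmetric] fiber_mass_y_def[symmetric]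
    using * by (intro measure_of_eq) (simp_all add: sigma_algebra.sigma_sets_eq sigma_algebra.axioms sigma_algebra_iff2)
qed

end

section \<open>Forgetful functors preserve unimodularity\<close>

text \<open>
  \<open>F\<close> models forgetting structure: vertices, neighborhoods and isomorphisms are kept, but a forgetful
  image may have additional isomorphisms.
\<close>

locale graph_functor =
  S: local_graph_space vertices iso nbhd graphs +
  T: local_graph_space vertices' iso' nbhd' graphs'
  for vertices :: "'g \<Rightarrow> nat set"
    and iso :: "'g \<Rightarrow> 'g \<Rightarrow> (nat \<Rightarrow> nat) \<Rightarrow> bool"
    and nbhd :: "nat \<Rightarrow> 'g \<Rightarrow> nat \<Rightarrow> 'g"
    and graphs :: "'g set"
    and vertices' :: "'h \<Rightarrow> nat set"
    and iso' :: "'h \<Rightarrow> 'h \<Rightarrow> (nat \<Rightarrow> nat) \<Rightarrow> bool"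
    and nbhd' :: "nat \<Rightarrow> 'h \<Rightarrow> nat \<Rightarrow> 'h"
    and graphs' :: "'h set" +
  fixes F :: "'g \<Rightarrow> 'h"
  assumes F_graphs: "G \<in> graphs \<Longrightarrow> F G \<in> graphs'"
    and F_vertices: "vertices' (F G) = vertices G"
    and F_iso: "iso G H \<phi> \<Longrightarrow> iso' (F G) (F H) \<phi>"
    and F_nbhd: "nbhd' r (F G) x = F (nbhd r G x)"
begin

definition map_root :: "('g \<times> nat) set \<Rightarrow> ('h \<times> nat) set" where
  "map_root p = T.rooted_iso `` ((\<lambda>(G, x). (F G, x)) ` p)"

definition map_biroot :: "('g \<times> nat \<times> nat) set \<Rightarrow> ('h \<times> nat \<times> nat) set" where
  "map_biroot c = T.birooted_iso `` ((\<lambda>(G, x, y). (F G, x, y)) ` c)"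

lemma F_rooted: "(G, x) \<in> S.rooted \<Longrightarrow> (F G, x) \<in> T.rooted"
  by (simp add: S.rooted_def T.rooted_def F_graphs F_vertices)

lemma F_birooted: "(G, x, y) \<in> S.birooted \<Longrightarrow> (F G, x, y) \<in> T.birooted"
  by (simp add: S.birooted_def T.birooted_def F_graphs F_vertices)

lemma map_root_class:
  assumes "(G, x) \<in> S.rooted"
  shows "map_root (S.root_class G x) = T.root_class (F G) x"
proof -
  have "T.root_class (F H) u = T.root_class (F G) x" if "(H, u) \<in> S.root_class G x" for H u
  proof -
    obtain \<phi> where "(H, u) \<in> S.rooted" "iso G H \<phi>" "\<phi> x = u"
      using \<open>(H, u) \<in> S.root_class G x\<close> by (auto simp: S.rooted_iso_def)
    then show ?thesis
      using T.root_class_eq_iff[OF F_rooted[OF assms] F_rooted, of H u] F_iso[of G H \<phi>] by blast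
  qed
  then have "T.rooted_iso `` {q} = T.root_class (F G) x"
    if "q \<in> (\<lambda>(G, x). (F G, x)) ` S.root_class G x" for q
    using that by fast
  moreover have "(\<lambda>(G, x). (F G, x)) ` S.root_class G x \<noteq> {}"
    using S.mem_root_class[OF assms] by blast
  ultimately have "(\<Union>q \<in> (\<lambda>(G, x). (F G, x)) ` S.root_class G x. T.rooted_iso `` {q}) = T.root_class (F G) x"
    by (rule SUP_eq_const[rotated])
  then show ?thesis
    unfolding map_root_def by (subst Image_eq_UN)
qed

lemma map_biroot_class:
  assumes "(G, x, y) \<in> S.birooted"
  shows "map_biroot (S.biroot_class G x y) = T.biroot_class (F G) x y"
proof -
  have "T.biroot_class (F H) u v = T.biroot_class (F G) x y"
    if "(H, u, v) \<in> S.biroot_class G x y" for H u v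
  proof -
    obtain \<phi> where "(H, u, v) \<in> S.birooted" "iso G H \<phi>" "\<phi> x = u" "\<phi> y = v"
      using \<open>(H, u, v) \<in> S.biroot_class G x y\<close> by (auto simp: S.birooted_iso_def)
    then show ?thesis
      using T.biroot_class_eq_iff[OF F_birooted[OF assms] F_birooted, of H u v] F_iso[of G H \<phi>] by blast
  qed
  then have "T.birooted_iso `` {q} = T.biroot_class (F G) x y"
    if "q \<in> (\<lambda>(G, x, y). (F G, x, y)) ` S.biroot_class G x y" for q
    using that by fast
  moreover have "(\<lambda>(G, x, y). (F G, x, y)) ` S.biroot_class G x y \<noteq> {}"
    using S.mem_biroot_class[OF assms] by blast
  ultimately have "(\<Union>q \<in> (\<lambda>(G, x, y). (F G, x, y)) ` S.biroot_class G x y. T.birooted_iso `` {q}) =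
      T.biroot_class (F G) x y"
    by (rule SUP_eq_const[rotated])
  then show ?thesis
    unfolding map_biroot_def by (subst Image_eq_UN)
qed

lemma map_root_in: "p \<in> S.rooted_classes \<Longrightarrow> map_root p \<in> T.rooted_classes"
  by (elim S.rooted_classesE) (simp add: map_root_class F_rooted T.root_class_in)

lemma map_biroot_in: "c \<in> S.birooted_classes \<Longrightarrow> map_biroot c \<in> T.birooted_classes"
  by (elim S.birooted_classesE) (simp add: map_biroot_class F_birooted T.biroot_class_in)

lemma near_F: "(H, u) \<in> S.near r G x \<Longrightarrow> (F H, u) \<in> T.near r (F G) x"
  by (erule S.nearE) (auto intro!: T.nearI F_rooted dest: F_iso simp: F_nbhd)

lemma binear_F: "(H, u, v) \<in> S.binear r G x y \<Longrightarrow> (F H, u, v) \<in> T.binear r (F G) x y"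
  by (erule S.binearE) (auto intro!: T.binearI F_birooted dest: F_iso simp: F_nbhd F_vertices)

lemma measurable_map_root: "map_root \<in> S.borel_sets \<rightarrow>\<^sub>M T.borel_sets"
proof (rule measurable_sigma_sets[OF T.sets_borel_sets T.open_subset_rooted_classes])
  show "map_root \<in> space S.borel_sets \<rightarrow> T.rooted_classes"
    by (auto simp: S.space_borel_sets intro: map_root_in)
  fix A assume "A \<in> {A. openin T.cylinder_topology A}"
  then have A: "openin T.cylinder_topology A" by simp
  have "openin S.cylinder_topology (map_root -` A \<inter> S.rooted_classes)"
  proof (rule S.openin_cylinder_topologyI)
    fix G x assume G: "(G, x) \<in> S.rooted" "S.root_class G x \<in> map_root -` A \<inter> S.rooted_classes"
    then have "T.root_class (F G) x \<in> A" by (simp add: map_root_class)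
    then obtain r where r: "\<forall>(H, u) \<in> T.near r (F G) x. T.root_class H u \<in> A"
      using T.openin_cylinder_topologyD(2)[OF A F_rooted[OF G(1)]] by blast
    have "S.root_class H u \<in> map_root -` A \<inter> S.rooted_classes" if near: "(H, u) \<in> S.near r G x" for H u
    proof -
      have H: "(H, u) \<in> S.rooted" using near by (rule S.nearE)
      moreover have "T.root_class (F H) u \<in> A" using r near_F[OF near] by blast
      ultimately show ?thesis by (simp add: map_root_class S.root_class_in)
    qed
    then show "\<exists>r. \<forall>(H, u) \<in> S.near r G x. S.root_class H u \<in> map_root -` A \<inter> S.rooted_classes"
      by blast
  qed simp
  then show "map_root -` A \<inter> space S.borel_sets \<in> sets S.borel_sets"
    by (simp add: S.space_borel_sets S.open_in_borel_sets)
qed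

lemma measurable_map_biroot: "map_biroot \<in> S.biborel_sets \<rightarrow>\<^sub>M T.biborel_sets"
proof (rule measurable_sigma_sets[OF T.sets_biborel_sets T.open_subset_birooted_classes])
  show "map_biroot \<in> space S.biborel_sets \<rightarrow> T.birooted_classes"
    by (auto simp: S.space_biborel_sets intro: map_biroot_in)
  fix A assume "A \<in> {A. openin T.bicylinder_topology A}"
  then have A: "openin T.bicylinder_topology A" by simp
  have "openin S.bicylinder_topology (map_biroot -` A \<inter> S.birooted_classes)"
  proof (rule S.openin_bicylinder_topologyI)
    fix G x y
    assume G: "(G, x, y) \<in> S.birooted" "S.biroot_class G x y \<in> map_biroot -` A \<inter> S.birooted_classes"
    then have "T.biroot_class (F G) x y \<in> A" by (simp add: map_biroot_class)
    then obtain r where r: "y \<in> vertices' (nbhd' r (F G) x)"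
        "\<forall>(H, u, v) \<in> T.binear r (F G) x y. T.biroot_class H u v \<in> A"
      using T.openin_bicylinder_topologyD(2)[OF A F_birooted[OF G(1)]] by blast
    have "S.biroot_class H u v \<in> map_biroot -` A \<inter> S.birooted_classes"
      if near: "(H, u, v) \<in> S.binear r G x y" for H u v
    proof -
      have H: "(H, u, v) \<in> S.birooted" using near by (rule S.binearE)
      moreover have "T.biroot_class (F H) u v \<in> A" using r(2) binear_F[OF near] by blast
      ultimately show ?thesis by (simp add: map_biroot_class S.biroot_class_in)
    qed
    moreover have "y \<in> vertices (nbhd r G x)" using r(1) by (simp add: F_nbhd F_vertices)
    ultimately show "\<exists>r. y \<in> vertices (nbhd r G x) \<and>
        (\<forall>(H, u, v) \<in> S.binear r G x y. S.biroot_class H u v \<in> map_biroot -` A \<inter> S.birooted_classes)"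
      by blast
  qed simp
  then show "map_biroot -` A \<inter> space S.biborel_sets \<in> sets S.biborel_sets"
    by (simp add: S.space_biborel_sets S.open_in_biborel_sets)
qed

text \<open>
  Over \<open>(G, x)\<close> and over \<open>(F G, x)\<close> the fiber masses count the same vertices, since \<open>F\<close> preserves the
  vertex set.
\<close>

lemma fiber_mass_map_root:
  assumes "p \<in> S.rooted_classes"
  shows "T.fiber_mass_x (map_root p) B = S.fiber_mass_x p (map_biroot -` B \<inter> S.birooted_classes)"
    and "T.fiber_mass_y (map_root p) B = S.fiber_mass_y p (map_biroot -` B \<inter> S.birooted_classes)"
proof -
  obtain G x where G: "(G, x) \<in> S.rooted" "p = S.root_class G x"
    using assms by (rule S.rooted_classesE)
  have "(G, x, y) \<in> S.birooted" "(G, y, x) \<in> S.birooted" if "y \<in> vertices G" for y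
    using G(1) that by (simp_all add: S.rooted_def S.birooted_def)
  then have
    "{y \<in> vertices G. S.biroot_class G x y \<in> map_biroot -` B \<inter> S.birooted_classes} =
      {y \<in> vertices' (F G). T.biroot_class (F G) x y \<in> B}"
    "{y \<in> vertices G. S.biroot_class G y x \<in> map_biroot -` B \<inter> S.birooted_classes} =
      {y \<in> vertices' (F G). T.biroot_class (F G) y x \<in> B}"
    by (auto simp: map_biroot_class F_vertices intro: S.biroot_class_in)
  then show "T.fiber_mass_x (map_root p) B = S.fiber_mass_x p (map_biroot -` B \<inter> S.birooted_classes)"
    "T.fiber_mass_y (map_root p) B = S.fiber_mass_y p (map_biroot -` B \<inter> S.birooted_classes)"
    unfolding G(2) map_root_class[OF G(1)]
      S.fiber_mass_x_class[OF G(1)] S.fiber_mass_y_class[OF G(1)]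
      T.fiber_mass_x_class[OF F_rooted[OF G(1)]] T.fiber_mass_y_class[OF F_rooted[OF G(1)]]
    by simp_all
qed

text \<open>
  By the preceding lemma each lift of the image measure is the image of the corresponding lift under
  \<^term>\<open>map_biroot\<close>. If the lifts agree, so do their images.
\<close>

theorem unimodular_distr:
  assumes "\<mu> \<in> S.unimodular_measures"
  shows "distr \<mu> T.borel_sets map_root \<in> T.unimodular_measures"
proof -
  have \<mu>: "prob_space \<mu>" "sets \<mu> = sets S.borel_sets" "S.lift_x \<mu> = S.lift_y \<mu>"
    using assms by (auto simp: S.unimodular_measures_def)
  have space: "space \<mu> = S.rooted_classes"
    using sets_eq_imp_space_eq[OF \<mu>(2)] by (simp add: S.space_borel_sets)
  have meas: "map_root \<in> \<mu> \<rightarrow>\<^sub>M T.borel_sets"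
    using measurable_map_root measurable_cong_sets[OF \<mu>(2) refl] by blast
  let ?\<nu> = "distr \<mu> T.borel_sets map_root"
  have "(\<integral>\<^sup>+ q. T.fiber_mass_x q B \<partial>?\<nu>) = (\<integral>\<^sup>+ q. T.fiber_mass_y q B \<partial>?\<nu>)"
    if B: "B \<in> sets T.biborel_sets" for B
  proof -
    define C where "C = map_biroot -` B \<inter> S.birooted_classes"
    have C: "C \<in> sets S.biborel_sets"
      using measurable_sets[OF measurable_map_biroot B] by (simp add: C_def S.space_biborel_sets)
    have "(\<integral>\<^sup>+ q. T.fiber_mass_x q B \<partial>?\<nu>) = (\<integral>\<^sup>+ p. T.fiber_mass_x (map_root p) B \<partial>\<mu>)"
      using T.measurable_fiber_mass_x[OF B] by (intro nn_integral_distr[OF meas]) simp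
    also have "\<dots> = (\<integral>\<^sup>+ p. S.fiber_mass_x p C \<partial>\<mu>)"
      by (intro nn_integral_cong) (simp add: space C_def fiber_mass_map_root)
    also have "\<dots> = (\<integral>\<^sup>+ p. S.fiber_mass_y p C \<partial>\<mu>)"
      using S.lift_x_eq_lift_y_iff[OF \<mu>(2)] \<mu>(3) C by blast
    also have "\<dots> = (\<integral>\<^sup>+ p. T.fiber_mass_y (map_root p) B \<partial>\<mu>)"
      by (intro nn_integral_cong) (simp add: space C_def fiber_mass_map_root)
    also have "\<dots> = (\<integral>\<^sup>+ q. T.fiber_mass_y q B \<partial>?\<nu>)"
      using T.measurable_fiber_mass_y[OF B] by (intro nn_integral_distr[OF meas, symmetric]) simp
    finally show ?thesis .
  qed
  then have "T.lift_x ?\<nu> = T.lift_y ?\<nu>"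
    by (subst T.lift_x_eq_lift_y_iff) simp_all
  then show ?thesis
    using prob_space.prob_space_distr[OF \<mu>(1) meas] by (simp add: T.unimodular_measures_def)
qed

end

section \<open>Multigraphs and Schreier graphs\<close>

lemma multigraph_iso_id: "multigraph_iso G G id"
  unfolding multigraph_iso_def
  by (auto simp: uprod.map_id intro!: exI[of _ id])

lemma labeled_iso_id: "labeled_iso G G id"
  unfolding labeled_iso_def by (auto intro!: exI[of _ id])

lemma multigraph_iso_comp:
  assumes "multigraph_iso G H \<phi>" "multigraph_iso H K \<psi>"
  shows "multigraph_iso G K (\<psi> \<circ> \<phi>)"
proof -
  obtain f g where
    "bij_betw f (medges G) (medges H)" "\<forall>e\<in>medges G. mends H (f e) = map_uprod \<phi> (mends G e)"
    "bij_betw g (medges H) (medges K)" "\<forall>e\<in>medges H. mends K (g e) = map_uprod \<psi> (mends H e)"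
    using assms by (auto simp: multigraph_iso_def)
  moreover from this have "bij_betw (g \<circ> f) (medges G) (medges K)" by (blast intro: bij_betw_trans)
  moreover from calculation have "\<forall>e\<in>medges G. mends K ((g \<circ> f) e) = map_uprod (\<psi> \<circ> \<phi>) (mends G e)"
    by (simp add: bij_betw_apply uprod.map_comp)
  moreover have "bij_betw (\<psi> \<circ> \<phi>) (mverts G) (mverts K)"
    using assms by (auto simp: multigraph_iso_def intro: bij_betw_trans)
  ultimately show ?thesis unfolding multigraph_iso_def by blast
qed

lemma labeled_iso_comp:
  assumes "labeled_iso G H \<phi>" "labeled_iso H K \<psi>"
  shows "labeled_iso G K (\<psi> \<circ> \<phi>)"
proof -
  obtain f g where f: "bij_betw f (arcs G) (arcs H)"
      "\<forall>e\<in>arcs G. tail H (f e) = \<phi> (tail G e) \<and> head H (f e) = \<phi> (head G e) \<and> label H (f e) = label G e"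
    and g: "bij_betw g (arcs H) (arcs K)"
      "\<forall>e\<in>arcs H. tail K (g e) = \<psi> (tail H e) \<and> head K (g e) = \<psi> (head H e) \<and> label K (g e) = label H e"
    using assms by (auto simp: labeled_iso_def)
  have "bij_betw (g \<circ> f) (arcs G) (arcs K)" using f g by (blast intro: bij_betw_trans)
  moreover have "\<forall>e\<in>arcs G. tail K ((g \<circ> f) e) = (\<psi> \<circ> \<phi>) (tail G e) \<and>
      head K ((g \<circ> f) e) = (\<psi> \<circ> \<phi>) (head G e) \<and> label K ((g \<circ> f) e) = label G e"
    using f g by (simp add: bij_betw_apply)
  moreover have "bij_betw (\<psi> \<circ> \<phi>) (verts G) (verts K)"
    using assms by (auto simp: labeled_iso_def intro: bij_betw_trans)
  ultimately show ?thesis unfolding labeled_iso_def by blast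
qed

lemma multigraph_iso_inv:
  assumes "multigraph_wf G" "multigraph_iso G H \<phi>"
  shows "multigraph_iso H G (inv_into (mverts G) \<phi>)"
proof -
  have \<phi>: "bij_betw \<phi> (mverts G) (mverts H)" using assms by (simp add: multigraph_iso_def)
  obtain f where f: "bij_betw f (medges G) (medges H)"
      "\<forall>e\<in>medges G. mends H (f e) = map_uprod \<phi> (mends G e)"
    using assms by (auto simp: multigraph_iso_def)
  have "mends G (inv_into (medges G) f e) = map_uprod (inv_into (mverts G) \<phi>) (mends H e)"
    if "e \<in> medges H" for e
  proof -
    let ?d = "inv_into (medges G) f e"
    have d: "?d \<in> medges G" "f ?d = e"
      using that f(1) by (auto simp: bij_betw_def f_inv_into_f inv_into_into)
    then have "map_uprod (inv_into (mverts G) \<phi>) (mends H e) =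
        map_uprod (inv_into (mverts G) \<phi> \<circ> \<phi>) (mends G ?d)"
      using f(2) by (metis uprod.map_comp)
    also have "\<dots> = map_uprod id (mends G ?d)"
    proof (rule uprod.map_cong0)
      fix z assume "z \<in> set_uprod (mends G ?d)"
      then have "z \<in> mverts G" using assms(1) d by (auto simp: multigraph_wf_def)
      then show "(inv_into (mverts G) \<phi> \<circ> \<phi>) z = id z"
        using bij_betw_inv_into_left[OF \<phi>] by simp
    qed
    finally show ?thesis by (simp add: uprod.map_id)
  qed
  then show ?thesis
    unfolding multigraph_iso_def using bij_betw_inv_into[OF \<phi>] bij_betw_inv_into[OF f(1)] by blast
qed

lemma labeled_iso_inv:
  assumes "multigraph_wf (underlying G)" "labeled_iso G H \<phi>"
  shows "labeled_iso H G (inv_into (verts G) \<phi>)"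
proof -
  have \<phi>: "bij_betw \<phi> (verts G) (verts H)" using assms by (simp add: labeled_iso_def)
  obtain f where f: "bij_betw f (arcs G) (arcs H)"
      "\<forall>e\<in>arcs G. tail H (f e) = \<phi> (tail G e) \<and> head H (f e) = \<phi> (head G e) \<and> label H (f e) = label G e"
    using assms by (auto simp: labeled_iso_def)
  have "tail G (inv_into (arcs G) f e) = inv_into (verts G) \<phi> (tail H e) \<and>
      head G (inv_into (arcs G) f e) = inv_into (verts G) \<phi> (head H e) \<and>
      label G (inv_into (arcs G) f e) = label H e" if "e \<in> arcs H" for e
  proof -
    let ?d = "inv_into (arcs G) f e"
    have d: "?d \<in> arcs G" "f ?d = e"
      using that f(1) by (auto simp: bij_betw_def f_inv_into_f inv_into_into)
    then have "tail G ?d \<in> verts G" "head G ?d \<in> verts G"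
      using assms(1) by (auto simp: multigraph_wf_def underlying_def)
    moreover have "tail H e = \<phi> (tail G ?d)" "head H e = \<phi> (head G ?d)" "label H e = label G ?d"
      using f(2) d by auto
    ultimately show ?thesis using bij_betw_inv_into_left[OF \<phi>] by simp
  qed
  then show ?thesis
    unfolding labeled_iso_def using bij_betw_inv_into[OF \<phi>] bij_betw_inv_into[OF f(1)] by blast
qed

lemma underlying_iso:
  assumes "labeled_iso G H \<phi>"
  shows "multigraph_iso (underlying G) (underlying H) \<phi>"
  using assms by (fastforce simp: labeled_iso_def multigraph_iso_def underlying_def)

lemma underlying_nbhd: "multigraph_nbhd r (underlying G) x = underlying (labeled_nbhd r G x)"
  by (simp add: multigraph_nbhd_def labeled_nbhd_def underlying_def)

lemma madj_iso:
  assumes "multigraph_iso G H \<phi>" "(u, v) \<in> madj G"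
  shows "(\<phi> u, \<phi> v) \<in> madj H"
proof -
  obtain f where f: "bij_betw f (medges G) (medges H)"
      "\<forall>e\<in>medges G. mends H (f e) = map_uprod \<phi> (mends G e)"
    using assms by (auto simp: multigraph_iso_def)
  obtain e where e: "e \<in> medges G" "mends G e = Upair u v"
    using assms(2) by (auto simp: madj_def)
  then have "f e \<in> medges H" "mends H (f e) = Upair (\<phi> u) (\<phi> v)"
    using f by (auto simp: bij_betw_apply)
  then show ?thesis by (auto simp: madj_def)
qed

lemma madj_relpow_iso:
  assumes "multigraph_iso G H \<phi>"
  shows "(u, v) \<in> madj G ^^ k \<Longrightarrow> (\<phi> u, \<phi> v) \<in> madj H ^^ k"
proof (induction k arbitrary: v)
  case (Suc k)
  then show ?case using madj_iso[OF assms] by (auto simp: relcomp_unfold)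
qed simp

lemma mball_subset_iso:
  assumes "multigraph_iso G H \<phi>"
  shows "\<phi> ` mball r G x \<subseteq> mball r H (\<phi> x)"
  using madj_relpow_iso[OF assms] assms
  by (fastforce simp: mball_def multigraph_iso_def bij_betw_def)

lemma mball_iso:
  assumes "multigraph_wf G" "multigraph_iso G H \<phi>" "x \<in> mverts G"
  shows "mball r H (\<phi> x) = \<phi> ` mball r G x"
proof (intro equalityI mball_subset_iso[OF assms(2)] subsetI)
  have \<phi>: "bij_betw \<phi> (mverts G) (mverts H)" using assms by (simp add: multigraph_iso_def)
  let ?\<psi> = "inv_into (mverts G) \<phi>"
  fix w assume w: "w \<in> mball r H (\<phi> x)"
  have "?\<psi> ` mball r H (\<phi> x) \<subseteq> mball r G (?\<psi> (\<phi> x))"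
    by (rule mball_subset_iso[OF multigraph_iso_inv[OF assms(1,2)]])
  with w have "?\<psi> w \<in> mball r G x"
    using bij_betw_inv_into_left[OF \<phi> assms(3)] by auto
  moreover have "\<phi> (?\<psi> w) = w"
    using w bij_betw_inv_into_right[OF \<phi>] by (simp add: mball_def)
  ultimately show "w \<in> \<phi> ` mball r G x" by (metis imageI)
qed

lemma mball_subset_mverts: "mball r G x \<subseteq> mverts G"
  by (auto simp: mball_def)

lemma bij_betw_mball:
  assumes "multigraph_wf G" "multigraph_iso G H \<phi>" "x \<in> mverts G"
  shows "bij_betw \<phi> (mball r G x) (mball r H (\<phi> x))"
  using assms mball_iso[OF assms] mball_subset_mverts[of r G x]
  by (auto simp: multigraph_iso_def bij_betw_def intro: inj_on_subset)

lemma multigraph_iso_nbhd: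
  assumes "multigraph_wf G" "multigraph_iso G H \<phi>" "x \<in> mverts G"
  shows "multigraph_iso (multigraph_nbhd r G x) (multigraph_nbhd r H (\<phi> x)) \<phi>"
proof -
  have inj: "inj_on \<phi> (mverts G)" using assms by (simp add: multigraph_iso_def bij_betw_def)
  obtain f where f: "bij_betw f (medges G) (medges H)"
      "\<forall>e\<in>medges G. mends H (f e) = map_uprod \<phi> (mends G e)"
    using assms by (auto simp: multigraph_iso_def)
  have "set_uprod (mends H (f e)) \<subseteq> mball r H (\<phi> x) \<longleftrightarrow> set_uprod (mends G e) \<subseteq> mball r G x"
    if "e \<in> medges G" for e
    using that assms(1) f(2) inj_on_image_subset_iff[OF inj, of "set_uprod (mends G e)" "mball r G x"]
    by (simp add: mball_iso[OF assms] uprod.set_map multigraph_wf_def mball_subset_mverts)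
  then have "bij_betw f {e \<in> medges G. set_uprod (mends G e) \<subseteq> mball r G x}
      {e \<in> medges H. set_uprod (mends H e) \<subseteq> mball r H (\<phi> x)}"
    by (rule bij_betw_Collect[OF f(1)])
  then show ?thesis
    using f(2) bij_betw_mball[OF assms] unfolding multigraph_iso_def multigraph_nbhd_def
    by (auto intro!: exI[of _ f])
qed

lemma labeled_iso_nbhd:
  assumes "multigraph_wf (underlying G)" "labeled_iso G H \<phi>" "x \<in> verts G"
  shows "labeled_iso (labeled_nbhd r G x) (labeled_nbhd r H (\<phi> x)) \<phi>"
proof -
  let ?B = "mball r (underlying G) x" and ?C = "mball r (underlying H) (\<phi> x)"
  have u: "multigraph_iso (underlying G) (underlying H) \<phi>" using assms(2) by (rule underlying_iso)
  have x: "x \<in> mverts (underlying G)" using assms(3) by (simp add: underlying_def)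
  have inj: "inj_on \<phi> (verts G)" using assms by (simp add: labeled_iso_def bij_betw_def)
  have sub: "?B \<subseteq> verts G" using mball_subset_mverts[of r "underlying G" x] by (simp add: underlying_def)
  obtain f where f: "bij_betw f (arcs G) (arcs H)"
      "\<forall>e\<in>arcs G. tail H (f e) = \<phi> (tail G e) \<and> head H (f e) = \<phi> (head G e) \<and> label H (f e) = label G e"
    using assms by (auto simp: labeled_iso_def)
  have "{tail H (f e), head H (f e)} \<subseteq> ?C \<longleftrightarrow> {tail G e, head G e} \<subseteq> ?B" if "e \<in> arcs G" for e
  proof -
    have "{tail G e, head G e} \<subseteq> verts G"
      using that assms(1) by (auto simp: multigraph_wf_def underlying_def)
    from inj_on_image_subset_iff[OF inj this sub] show ?thesis
      using that f(2) by (simp add: mball_iso[OF assms(1) u x])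
  qed
  then have "bij_betw f {e \<in> arcs G. {tail G e, head G e} \<subseteq> ?B} {e \<in> arcs H. {tail H e, head H e} \<subseteq> ?C}"
    by (rule bij_betw_Collect[OF f(1)])
  then show ?thesis
    using f(2) bij_betw_mball[OF assms(1) u x] unfolding labeled_iso_def labeled_nbhd_def
    by (auto intro!: exI[of _ f])
qed

lemma mball_mono: "s \<le> r \<Longrightarrow> mball s G x \<subseteq> mball r G x"
  using order_trans by (fastforce simp: mball_def)

lemma madj_nbhd_subset: "madj (multigraph_nbhd r G x) \<subseteq> madj G"
  by (auto simp: madj_def multigraph_nbhd_def)

lemma madj_mverts: "multigraph_wf G \<Longrightarrow> (u, v) \<in> madj G \<Longrightarrow> u \<in> mverts G \<and> v \<in> mverts G"
  by (force simp: madj_def multigraph_wf_def)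

lemma mball_trans:
  assumes "y \<in> mball k G x" "k + s \<le> r"
  shows "mball s G y \<subseteq> mball r G x"
proof
  fix v assume "v \<in> mball s G y"
  then obtain j i where "v \<in> mverts G" "j \<le> s" "(y, v) \<in> madj G ^^ j" "i \<le> k" "(x, y) \<in> madj G ^^ i"
    using assms(1) by (auto simp: mball_def)
  moreover from this have "(x, v) \<in> madj G ^^ (i + j)" by (auto simp: relpow_add)
  moreover have "i + j \<le> r" using calculation assms(2) by simp
  ultimately show "v \<in> mball r G x" by (auto simp: mball_def)
qed

text \<open>
  A path of length \<open>j\<close> that starts within distance \<open>k\<close> of \<open>x\<close> never leaves the \<open>(k + j)\<close>-neighborhood
  of \<open>x\<close>, so it is also a path in the induced subgraph on any larger neighborhood.
\<close>

lemma madj_relpow_nbhd: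
  assumes "multigraph_wf G" "y \<in> mball k G x"
  shows "(y, v) \<in> madj G ^^ j \<Longrightarrow> k + j \<le> r \<Longrightarrow>
    v \<in> mball (k + j) G x \<and> (y, v) \<in> madj (multigraph_nbhd r G x) ^^ j"
proof (induction j arbitrary: v)
  case 0
  then show ?case using assms by simp
next
  case (Suc j)
  then obtain w where w: "(y, w) \<in> madj G ^^ j" "(w, v) \<in> madj G" by auto
  with Suc have IH: "w \<in> mball (k + j) G x" "(y, w) \<in> madj (multigraph_nbhd r G x) ^^ j" by auto
  have "v \<in> mverts G" using madj_mverts[OF assms(1) w(2)] by simp
  then have "v \<in> mball 1 G w"
    using w(2) unfolding mball_def by (auto intro!: exI[of _ 1])
  then have v: "v \<in> mball (k + Suc j) G x" using mball_trans[OF IH(1), of 1 "k + Suc j"] by auto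
  moreover have "(w, v) \<in> madj (multigraph_nbhd r G x)"
  proof -
    have "mball (k + j) G x \<subseteq> mball r G x" "mball (k + Suc j) G x \<subseteq> mball r G x"
      using Suc.prems by (simp_all add: mball_mono)
    then have "{w, v} \<subseteq> mball r G x" using IH(1) v by blast
    then show ?thesis using w(2) by (force simp: madj_def multigraph_nbhd_def)
  qed
  ultimately show ?case using IH by auto
qed

lemma mball_nbhd:
  assumes "multigraph_wf G" "y \<in> mball k G x" "k + s \<le> r"
  shows "mball s (multigraph_nbhd r G x) y = mball s G y"
proof (intro equalityI subsetI)
  fix v assume "v \<in> mball s (multigraph_nbhd r G x) y"
  then obtain j where j: "v \<in> mball r G x" "j \<le> s" "(y, v) \<in> madj (multigraph_nbhd r G x) ^^ j"
    by (auto simp: mball_def[of s] multigraph_nbhd_def)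
  have "madj (multigraph_nbhd r G x) ^^ j \<subseteq> madj G ^^ j"
    by (induction j) (use madj_nbhd_subset[of r G x] in \<open>auto intro: relcomp_mono\<close>)
  with j show "v \<in> mball s G y"
    using mball_subset_mverts[of r G x] by (auto simp: mball_def[of s])
next
  fix v assume v: "v \<in> mball s G y"
  then obtain j where "j \<le> s" "(y, v) \<in> madj G ^^ j" by (auto simp: mball_def)
  moreover from this have "(y, v) \<in> madj (multigraph_nbhd r G x) ^^ j"
    using madj_relpow_nbhd[OF assms(1,2), of v j r] assms(3) by simp
  moreover have "v \<in> mverts (multigraph_nbhd r G x)"
    using mball_trans[OF assms(2,3)] v by (auto simp: multigraph_nbhd_def)
  ultimately show "v \<in> mball s (multigraph_nbhd r G x) y"
    unfolding mball_def[of s "multigraph_nbhd r G x"] by blast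
qed

text \<open>
  Taking neighborhoods is intrinsic: distances from \<open>y\<close> up to \<open>s\<close> can be measured inside the larger
  neighborhood of \<open>x\<close>. Hence an isomorphism of large neighborhoods, which is an isomorphism of graphs
  in its own right, restricts to neighborhoods of inner points.
\<close>

lemma multigraph_nbhd_nbhd:
  assumes "multigraph_wf G" "y \<in> mball k G x" "k + s \<le> r"
  shows "multigraph_nbhd s (multigraph_nbhd r G x) y = multigraph_nbhd s G y"
proof -
  have "{e \<in> medges (multigraph_nbhd r G x). set_uprod (mends G e) \<subseteq> mball s G y} =
      {e \<in> medges G. set_uprod (mends G e) \<subseteq> mball s G y}"
    using mball_trans[OF assms(2,3)] by (auto simp: multigraph_nbhd_def)
  then show ?thesis
    using mball_nbhd[OF assms] by (simp add: multigraph_nbhd_def[of s] multigraph_nbhd_def[of r])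
qed

lemma labeled_nbhd_nbhd:
  assumes "multigraph_wf (underlying G)" "y \<in> mball k (underlying G) x" "k + s \<le> r"
  shows "labeled_nbhd s (labeled_nbhd r G x) y = labeled_nbhd s G y"
proof -
  have "mball s (underlying (labeled_nbhd r G x)) y = mball s (underlying G) y"
    using mball_nbhd[OF assms] by (simp add: underlying_nbhd)
  moreover have "{e \<in> arcs (labeled_nbhd r G x). {tail G e, head G e} \<subseteq> mball s (underlying G) y} =
      {e \<in> arcs G. {tail G e, head G e} \<subseteq> mball s (underlying G) y}"
    using mball_trans[OF assms(2,3)] by (auto simp: labeled_nbhd_def)
  ultimately show ?thesis
    by (simp add: labeled_nbhd_def[of s] labeled_nbhd_def[of r])
qed

lemma multigraph_wf_nbhd: "multigraph_wf (multigraph_nbhd r G x)"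
  by (auto simp: multigraph_wf_def multigraph_nbhd_def)

lemma mverts_nbhd [simp]: "mverts (multigraph_nbhd r G x) = mball r G x"
  by (simp add: multigraph_nbhd_def)

lemma verts_nbhd [simp]: "verts (labeled_nbhd r G x) = mball r (underlying G) x"
  by (simp add: labeled_nbhd_def)

lemma root_in_mball: "x \<in> mverts G \<Longrightarrow> x \<in> mball r G x"
  by (auto simp: mball_def intro!: exI[of _ 0])

text \<open>
  Distances to the root up to \<open>r\<close> can be read off from the \<open>r\<close>-neighborhood, so an isomorphism of
  \<open>r\<close>-neighborhoods does not increase them.
\<close>

lemma mball_nbhd_iso:
  assumes "multigraph_wf G" "multigraph_wf H"
    and iso: "multigraph_iso (multigraph_nbhd r G x) (multigraph_nbhd r H (\<phi> x)) \<phi>"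
    and "x \<in> mverts G" "y \<in> mball k G x" "k \<le> r"
  shows "\<phi> y \<in> mball k H (\<phi> x)"
proof -
  have "\<phi> x \<in> mball r H (\<phi> x)"
    using iso root_in_mball[OF assms(4), of r] by (auto simp: multigraph_iso_def bij_betw_def)
  then have x': "\<phi> x \<in> mverts H" by (simp add: mball_def)
  \<comment> \<open>The radius \<open>0\<close> centers the inner neighborhood at the root itself.\<close>
  have "y \<in> mball k (multigraph_nbhd r G x) x"
    using mball_nbhd[OF assms(1) root_in_mball[OF assms(4), of 0], of k r] assms(5,6) by simp
  then have "\<phi> y \<in> mball k (multigraph_nbhd r H (\<phi> x)) (\<phi> x)"
    using mball_subset_iso[OF iso] by blast
  then show ?thesis
    using mball_nbhd[OF assms(2) root_in_mball[OF x', of 0], of k r] assms(6) by simp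
qed

lemma multigraph_iso_nbhd_nbhd:
  assumes "multigraph_wf G" "multigraph_wf H"
    and iso: "multigraph_iso (multigraph_nbhd r G x) (multigraph_nbhd r H (\<phi> x)) \<phi>"
    and "x \<in> mverts G" "y \<in> mball k G x" "k + s \<le> r"
  shows "multigraph_iso (multigraph_nbhd s G y) (multigraph_nbhd s H (\<phi> y)) \<phi>"
proof -
  have y: "y \<in> mverts (multigraph_nbhd r G x)" using assms(5,6) mball_mono[of k r G x] by auto
  have "\<phi> y \<in> mball k H (\<phi> x)" using assms by (intro mball_nbhd_iso[OF assms(1,2) iso]) simp_all
  then show ?thesis
    using multigraph_iso_nbhd[OF multigraph_wf_nbhd iso y, of s]
    by (simp add: multigraph_nbhd_nbhd[OF assms(1,5,6)] multigraph_nbhd_nbhd[OF assms(2) _ assms(6)])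
qed

lemma labeled_iso_nbhd_nbhd:
  assumes "multigraph_wf (underlying G)" "multigraph_wf (underlying H)"
    and iso: "labeled_iso (labeled_nbhd r G x) (labeled_nbhd r H (\<phi> x)) \<phi>"
    and "x \<in> verts G" "y \<in> mball k (underlying G) x" "k + s \<le> r"
  shows "labeled_iso (labeled_nbhd s G y) (labeled_nbhd s H (\<phi> y)) \<phi>"
proof -
  have y: "y \<in> verts (labeled_nbhd r G x)" using assms(5,6) mball_mono[of k r "underlying G" x] by auto
  have wf: "multigraph_wf (underlying (labeled_nbhd r G x))"
    using multigraph_wf_nbhd by (simp flip: underlying_nbhd)
  have "multigraph_iso (multigraph_nbhd r (underlying G) x) (multigraph_nbhd r (underlying H) (\<phi> x)) \<phi>"
    using underlying_iso[OF iso] by (simp add: underlying_nbhd)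
  moreover have "x \<in> mverts (underlying G)" using assms(4) by (simp add: underlying_def)
  moreover have "k \<le> r" using assms(6) by simp
  ultimately have "\<phi> y \<in> mball k (underlying H) (\<phi> x)"
    using mball_nbhd_iso[OF assms(1,2) _ _ assms(5)] by blast
  then show ?thesis
    using labeled_iso_nbhd[OF wf iso y, of s]
    by (simp add: labeled_nbhd_nbhd[OF assms(1,5,6)] labeled_nbhd_nbhd[OF assms(2) _ assms(6)])
qed

lemma finite_mball:
  assumes "G \<in> regular_multigraphs d"
  shows "finite (mball r G x)"
proof (induction r)
  case 0
  have "mball 0 G x \<subseteq> {x}" by (auto simp: mball_def)
  then show ?case using finite_subset by blast
next
  case (Suc r)
  let ?N = "\<lambda>v. \<Union>e \<in> {e \<in> medges G. v \<in> set_uprod (mends G e)}. set_uprod (mends G e)"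
  have wf: "multigraph_wf G" using assms by (simp add: regular_multigraphs_def)
  have "mball (Suc r) G x \<subseteq> {x} \<union> (\<Union>v \<in> mball r G x. ?N v)"
  proof
    fix z assume "z \<in> mball (Suc r) G x"
    then obtain k where k: "k \<le> Suc r" "(x, z) \<in> madj G ^^ k" by (auto simp: mball_def)
    show "z \<in> {x} \<union> (\<Union>v \<in> mball r G x. ?N v)"
    proof (cases k)
      case 0
      then show ?thesis using k by simp
    next
      case (Suc j)
      then obtain w where w: "(x, w) \<in> madj G ^^ j" "(w, z) \<in> madj G" using k by auto
      then have "w \<in> mball r G x" using madj_mverts[OF wf w(2)] k Suc by (auto simp: mball_def)
      moreover have "z \<in> ?N w" using w(2) by (force simp: madj_def)
      ultimately show ?thesis by blast
    qed
  qed
  moreover have "finite (set_uprod u)" for u :: "'a uprod" by (cases u) simp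
  then have "finite (?N v)" if "v \<in> mverts G" for v
    using assms that by (auto simp: regular_multigraphs_def)
  then have "finite ({x} \<union> (\<Union>v \<in> mball r G x. ?N v))"
    using Suc mball_subset_mverts[of r G x] by blast
  ultimately show ?case by (rule finite_subset)
qed

lemma Union_mball:
  assumes "multigraph_connected G" "x \<in> mverts G"
  shows "(\<Union>r. mball r G x) = mverts G"
proof (intro equalityI subsetI)
  fix v assume v: "v \<in> mverts G"
  with assms have "(x, v) \<in> (madj G)\<^sup>*" by (simp add: multigraph_connected_def)
  then obtain k where "(x, v) \<in> madj G ^^ k" using rtrancl_imp_relpow by blast
  with v show "v \<in> (\<Union>r. mball r G x)" by (auto simp: mball_def)
qed (auto simp: mball_def)

lemma local_graph_space_multigraph:
  "local_graph_space mverts multigraph_iso multigraph_nbhd (regular_multigraphs d :: (nat, nat) multigraph set)"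
proof -
  have reg: "multigraph_wf G" "multigraph_connected G" if "G \<in> regular_multigraphs d"
    for G :: "(nat, nat) multigraph"
    using that by (simp_all add: regular_multigraphs_def)
  show ?thesis
    by unfold_locales
      (auto simp: multigraph_iso_id multigraph_iso_comp multigraph_iso_inv multigraph_iso_nbhd
         multigraph_iso_nbhd_nbhd reg root_in_mball finite_mball Union_mball
         dest: mball_trans, simp add: multigraph_iso_def)
qed

lemma local_graph_space_schreier:
  "local_graph_space verts labeled_iso labeled_nbhd (schreier_graphs n :: (nat, nat) labeled_digraph set)"
proof -
  have reg: "underlying G \<in> regular_multigraphs (2 * n)" "multigraph_wf (underlying G)"
      "multigraph_connected (underlying G)" if "G \<in> schreier_graphs n"
    for G :: "(nat, nat) labeled_digraph"
    using that by (simp_all add: schreier_graphs_def regular_multigraphs_def)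
  have v: "mverts (underlying G) = verts G" for G :: "(nat, nat) labeled_digraph"
    by (simp add: underlying_def)
  show ?thesis
    by unfold_locales
      (auto simp: labeled_iso_id labeled_iso_comp labeled_iso_inv labeled_iso_nbhd
         labeled_iso_nbhd_nbhd reg root_in_mball finite_mball[OF reg(1)] Union_mball v
         dest: mball_trans, simp add: labeled_iso_def)
qed

lemma graph_functor_underlying:
  "graph_functor verts labeled_iso labeled_nbhd (schreier_graphs n :: (nat, nat) labeled_digraph set)
     mverts multigraph_iso multigraph_nbhd (regular_multigraphs (2 * n)) underlying"
  by (intro graph_functor.intro graph_functor_axioms.intro
        local_graph_space_schreier local_graph_space_multigraph underlying_iso underlying_nbhd)
    (simp_all add: schreier_graphs_def underlying_def)

theorem proposition5p3:
  fixes n :: nat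
  shows "(\<lambda>\<mu>. distr \<mu> (Omega_borel n) (forget n)) ` Lambda_unimodular n \<subseteq> Omega_unimodular n"
proof -
  interpret U: graph_functor verts labeled_iso labeled_nbhd "schreier_graphs n :: (nat, nat) labeled_digraph set"
      mverts multigraph_iso multigraph_nbhd "regular_multigraphs (2 * n)" underlying
    by (rule graph_functor_underlying)
  have "forget n = U.map_root"
    by (rule ext) (simp add: forget_def U.map_root_def Omega_iso_def)
  then show ?thesis
    using U.unimodular_distr
    unfolding Omega_borel_def Omega_unimodular_def Lambda_unimodular_def by auto
qed

end
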